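(* Let $D=\mathbb{R}$ or $D=\mathbb{Z}$. For any log-concave density $f$ on $D$ and any $\epsilon>0$, there exists a piecewise linear distribution $g$ on $D$ with $O(\epsilon^{-1/2})$ interval pieces such that $d_{\mathrm{TV}}(f,g)\le\epsilon$.
   Context: A density on $\mathbb{R}$ is a pdf w.r.t. Lebesgue measure; on $\mathbb{Z}$ a probability mass function. $f:\mathbb{R}\to\mathbb{R}_+$ is log-concave if $f=\exp(\phi)$ with $\phi$ concave with values in $[-\infty,\infty)$; $f:\mathbb{Z}\to[0,1]$ is log-concave if $f(x)^2\ge f(x-1)f(x+1)$ for all $x$ and $f$ has no internal zeroes. A piecewise linear distribution with $m$ interval pieces is a density on $D$ for which there is a partition of the domain into $m$ intervals such that on each interval the density coincides with an affine function $x\mapsto ax+b$ (restricted to $D$). $d_{\mathrm{TV}}(f,g)=\frac12\|f-g\|_1$. The constant in $O(\cdot)$ is absolute. *)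

theory Defs
  imports "HOL-Analysis.Analysis"
begin

text \<open>
  The domains \<open>\<real>\<close> and \<open>\<int>\<close> are the types \<^typ>\<open>real\<close> and \<^typ>\<open>int\<close> with the reference measures
  \<^term>\<open>lborel\<close> and \<^term>\<open>count_space (UNIV :: int set)\<close>; with respect to the latter a density is a
  probability mass function and the Bochner integral is the (absolutely convergent) sum.
\<close>

definition is_density :: "'a measure \<Rightarrow> ('a \<Rightarrow> real) \<Rightarrow> bool" where
  "is_density M f \<longleftrightarrow> (\<forall>x. 0 \<le> f x) \<and> has_bochner_integral M f 1"

definition tv_dist :: "'a measure \<Rightarrow> ('a \<Rightarrow> real) \<Rightarrow> ('a \<Rightarrow> real) \<Rightarrow> real" where
  "tv_dist M f g = 1 / 2 * (LINT x|M. \<bar>f x - g x\<bar>)"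

text \<open>
  Weights are taken in the open interval \<open>(0, 1)\<close>, so that the convention \<open>0 * (- \<infinity>) = 0\<close> plays no
  role; as \<open>\<infinity>\<close> is not a value, no sum \<open>\<infinity> + (- \<infinity>)\<close> occurs.
\<close>

definition extended_concave :: "(real \<Rightarrow> ereal) \<Rightarrow> bool" where
  "extended_concave \<phi> \<longleftrightarrow>
     (\<forall>x. \<phi> x \<noteq> \<infinity>) \<and>
     (\<forall>x y t. 0 < t \<and> t < 1 \<longrightarrow>
        ereal (1 - t) * \<phi> x + ereal t * \<phi> y \<le> \<phi> ((1 - t) * x + t * y))"

text \<open>Only used for arguments other than \<open>\<infinity>\<close>.\<close>

definition exp_ereal :: "ereal \<Rightarrow> real" where
  "exp_ereal u = (if u = - \<infinity> then 0 else exp (real_of_ereal u))"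

definition log_concave_real :: "(real \<Rightarrow> real) \<Rightarrow> bool" where
  "log_concave_real f \<longleftrightarrow> (\<exists>\<phi>. extended_concave \<phi> \<and> (\<forall>x. f x = exp_ereal (\<phi> x)))"

definition log_concave_int :: "(int \<Rightarrow> real) \<Rightarrow> bool" where
  "log_concave_int f \<longleftrightarrow>
     (\<forall>x. 0 \<le> f x \<and> f x \<le> 1) \<and>
     (\<forall>x. f (x - 1) * f (x + 1) \<le> (f x)\<^sup>2) \<and>
     (\<forall>x y z. x < y \<and> y < z \<and> f x \<noteq> 0 \<and> f z \<noteq> 0 \<longrightarrow> f y \<noteq> 0)"

text \<open>Bounded or unbounded, with or without endpoints; singletons are intervals.\<close>

definition order_interval :: "'a::linorder set \<Rightarrow> bool" where
  "order_interval I \<longleftrightarrow> (\<forall>a\<in>I. \<forall>b\<in>I. {a..b} \<subseteq> I)"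

text \<open>
  The argument \<open>\<iota>\<close> is the inclusion of the domain into the reals, so that affine functions always
  have real coefficients. A \<^const>\<open>partition_on\<close> has nonempty pieces.
\<close>

definition piecewise_affine :: "('a::linorder \<Rightarrow> real) \<Rightarrow> nat \<Rightarrow> ('a \<Rightarrow> real) \<Rightarrow> bool" where
  "piecewise_affine \<iota> m g \<longleftrightarrow>
     (\<exists>P. partition_on UNIV P \<and> finite P \<and> card P = m \<and>
        (\<forall>I\<in>P. order_interval I \<and> (\<exists>a b. \<forall>x\<in>I. g x = a * \<iota> x + b)))"

definition piecewise_linear_distribution_real :: "nat \<Rightarrow> (real \<Rightarrow> real) \<Rightarrow> bool" where
  "piecewise_linear_distribution_real m g \<longleftrightarrow>
     is_density lborel g \<and> piecewise_affine (\<lambda>x. x) m g"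

definition piecewise_linear_distribution_int :: "nat \<Rightarrow> (int \<Rightarrow> real) \<Rightarrow> bool" where
  "piecewise_linear_distribution_int m g \<longleftrightarrow>
     is_density (count_space UNIV) g \<and> piecewise_affine real_of_int m g"

end

theory Submission
  imports Defs
begin

text \<open>
  A log-concave sequence \<open>f = exp \<phi>\<close> is treated on either side of its mode, where it is cut into level
  blocks on which it drops by a factor of at most 8. On such a block \<open>\<phi>\<close> lies in a triangle over its
  chord; splitting at the point farthest above the chord gives two triangles whose areas sum to at
  most a quarter of the original one, so \<open>2 ^ d\<close> chords approximate \<open>\<phi>\<close> up to \<open>area / 4 ^ d\<close>. Adding
  nodes between which \<open>\<phi>\<close> drops by at most \<open>3 / 2 ^ d\<close> makes the passage from chords of \<open>\<phi>\<close> to chords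
  of \<open>f\<close> cost no more. Behind a level block at most an eighth of the mass remains, so the piece
  numbers \<open>2 ^ N, 2 ^ (N - 1), \<dots>\<close> may be used on successive blocks: the errors still sum to a
  multiple of \<open>4 ^ (- N)\<close>, with a multiple of \<open>2 ^ N\<close> pieces in total. All constants are independent of the
  sequence, so the case of the real line follows by sampling the density on a fine grid.
\<close>

section \<open>Chords and triangles\<close>

text \<open>The level factor 8 comes from a balance. Halving the number of chords multiplies the
  error by 4, so the mass left behind a block must shrink by more than 4; a factor 8 leaves the
  ratio 1/2, and the errors form a convergent geometric series. On the real line the obstacle is
  that a grid function pulled back along the floor is a step function with as many pieces as cells.
  Each affine block is therefore extended to the continuous grid coordinate, which changes the value
  by at most the absolute slope of the block. Summed over all grid points these slopes are at most
  \<open>2 * M * K\<close>, for values in \<open>[0, M]\<close> and \<open>K\<close> blocks,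
  whatever the mesh; multiplied by the mesh width they become negligible. For this reason the bounds
  \<open>0 \<le> h \<le> M\<close> are carried along with every approximation on the integers. The
  approximants need not have mass 1, and the extension may dip below 0 between grid points. Clipping
  at 0 and dividing by the mass repair this at the very end, at the price of twice as many
  pieces.\<close>

definition chord :: "(int \<Rightarrow> real) \<Rightarrow> int \<Rightarrow> int \<Rightarrow> int \<Rightarrow> real" where
  "chord \<phi> l r n =
     \<phi> l + (\<phi> r - \<phi> l) / (real_of_int r - real_of_int l) * (real_of_int n - real_of_int l)"

lemma chord_same [simp]: "chord \<phi> l r l = \<phi> l"
  by (simp add: chord_def)

text \<open>The weight is the same for every function, so that the chord of \<open>f\<close> and the
  chord of \<open>ln f\<close> over one interval can be compared.\<close>

lemma chord_convex_combination:
  assumes "l < r" "l \<le> n" "n \<le> r"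
  obtains w where "0 \<le> w" "w \<le> 1" "real_of_int n = (1 - w) * real_of_int l + w * real_of_int r"
    "\<And>\<phi>. chord \<phi> l r n = (1 - w) * \<phi> l + w * \<phi> r"
proof
  let ?w = "(real_of_int n - real_of_int l) / (real_of_int r - real_of_int l)"
  have pos: "real_of_int r - real_of_int l > 0" using assms by simp
  show "0 \<le> ?w" "?w \<le> 1" using assms pos by (auto simp: divide_simps)
  show "real_of_int n = (1 - ?w) * real_of_int l + ?w * real_of_int r"
  proof -
    have "real_of_int n = (1 - w) * real_of_int l + w * real_of_int r"
      if "w * (real_of_int r - real_of_int l) = real_of_int n - real_of_int l" for w
      using that by (simp add: algebra_simps)
    moreover have "?w * (real_of_int r - real_of_int l) = real_of_int n - real_of_int l"
      using pos by simp
    ultimately show ?thesis by blast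
  qed
  show "chord \<phi> l r n = (1 - ?w) * \<phi> l + ?w * \<phi> r" for \<phi>
    by (simp add: chord_def algebra_simps diff_divide_distrib)
qed

text \<open>The right side is the height of the triangle with base \<open>L\<close> and side slopes
  \<open>\<alpha>\<close>, \<open>\<beta>\<close>. Weighting the two bounds by
  \<open>\<beta>\<close> and \<open>\<alpha>\<close> eliminates \<open>t\<close>. If both slopes
  vanish, the convention 0 / 0 = 0 gives the correct height.\<close>

lemma harmonic_bound:
  fixes \<alpha> \<beta> t L :: real
  assumes "0 \<le> \<alpha>" "0 \<le> \<beta>" "0 \<le> t" "t \<le> L" "z \<le> \<alpha> * t" "z \<le> \<beta> * (L - t)"
  shows "z \<le> \<alpha> * \<beta> / (\<alpha> + \<beta>) * L"
proof (cases "\<alpha> + \<beta> = 0")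
  case True
  then show ?thesis using assms by (simp add: add_nonneg_eq_0_iff)
next
  case False
  then have pos: "\<alpha> + \<beta> > 0" using assms by linarith
  have "z * (\<alpha> + \<beta>) = \<beta> * z + \<alpha> * z" by (simp add: algebra_simps)
  also have "\<dots> \<le> \<beta> * (\<alpha> * t) + \<alpha> * (\<beta> * (L - t))"
    using assms by (intro add_mono mult_left_mono) auto
  also have "\<dots> = \<alpha> * \<beta> * L" by (simp add: algebra_simps)
  finally show ?thesis using pos by (simp add: field_simps)
qed

text \<open>With \<open>\<kappa> = \<alpha> * \<beta> / (\<alpha> + \<beta>)\<close> and base
  \<open>L\<close>, twice the area of the triangle is \<open>\<kappa> * L\<^sup>2\<close>. The
  summands are twice the areas of the triangles that remain when the farthest point has height
  \<open>M\<close>. Their sum \<open>M * L - M\<^sup>2 / \<kappa>\<close> is largest at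
  \<open>M = \<kappa> * L / 2\<close>, whence the square that is completed.\<close>

lemma triangle_split:
  fixes \<alpha> \<beta> M L1 L2 :: real
  assumes "0 < \<alpha>" "0 < \<beta>"
  shows "(M * L1 - M\<^sup>2 / \<alpha>) + (M * L2 - M\<^sup>2 / \<beta>) \<le> \<alpha> * \<beta> / (\<alpha> + \<beta>) * (L1 + L2)\<^sup>2 / 4"
proof -
  define \<kappa> where "\<kappa> = \<alpha> * \<beta> / (\<alpha> + \<beta>)"
  have \<kappa>: "\<kappa> > 0" using assms by (simp add: \<kappa>_def)
  have inv: "M\<^sup>2 / \<alpha> + M\<^sup>2 / \<beta> = M\<^sup>2 / \<kappa>" using assms by (simp add: \<kappa>_def field_simps)
  have "0 \<le> \<kappa> * ((L1 + L2) / 2 - M / \<kappa>)\<^sup>2" using \<kappa> by simp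
  also have "\<dots> = \<kappa> * (L1 + L2)\<^sup>2 / 4 - M * (L1 + L2) + M\<^sup>2 / \<kappa>"
    using \<kappa> by (simp add: power2_eq_square field_simps)
  finally show ?thesis using inv by (simp add: \<kappa>_def algebra_simps)
qed

text \<open>Here \<open>k\<close> is the slope of the chord, and \<open>\<alpha>\<close>,
  \<open>\<beta>\<close> are the slopes of the two sides relative to it. After a split, each smaller
  triangle has one old side and, as its second side, the line of slope \<open>k\<close> through the
  farthest point.\<close>

lemma triangle_nodes:
  fixes \<phi> :: "int \<Rightarrow> real"
  assumes "x < y" "0 \<le> \<alpha>" "0 \<le> \<beta>"
    and "\<phi> y - \<phi> x = k * (real_of_int y - real_of_int x)"
    and "\<And>n. n \<in> {x..y} \<Longrightarrow> \<phi> n \<le> \<phi> x + (k + \<alpha>) * (real_of_int n - real_of_int x)"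
    and "\<And>n. n \<in> {x..y} \<Longrightarrow> \<phi> n \<le> \<phi> y + (\<beta> - k) * (real_of_int y - real_of_int n)"
  shows "\<exists>X e. X \<subseteq> {x..y} \<and> x \<in> X \<and> y \<in> X \<and> card X \<le> 2 ^ d + 1 \<and> (\<forall>n. 0 \<le> e n) \<and>
    sum e {x..y} \<le> \<alpha> * \<beta> / (\<alpha> + \<beta>) * (real_of_int y - real_of_int x)\<^sup>2 / 4 ^ d \<and>
    (\<forall>n\<in>{x..y}. \<exists>l\<in>X. \<exists>r\<in>X. l \<le> n \<and> n \<le> r \<and> \<phi> n - chord \<phi> l r n \<le> e n)"
  using assms
proof (induction d arbitrary: x y k \<alpha> \<beta>)
  case 0
  define H where "H = \<alpha> * \<beta> / (\<alpha> + \<beta>) * (real_of_int y - real_of_int x)"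
  \<comment> \<open>The error is 0 at \<open>y\<close>, where the degenerate chord from
    \<open>y\<close> to \<open>y\<close> is exact. Thus there are exactly \<open>y - x\<close>
    nonzero terms at most, and the sum is base times height with no boundary term.\<close>
  define e where "e = (\<lambda>n. if n \<in> {x..<y} then H else 0)"
  have H: "H \<ge> 0" using 0 by (simp add: H_def)
  have pos: "real_of_int y - real_of_int x > 0" using 0 by simp
  have "sum e {x..y} = (\<Sum>n\<in>{x..<y}. H)"
    unfolding e_def by (intro sum.mono_neutral_cong_right) auto
  also have "\<dots> = \<alpha> * \<beta> / (\<alpha> + \<beta>) * (real_of_int y - real_of_int x)\<^sup>2"
    using 0 by (simp add: H_def power2_eq_square)
  finally have s: "sum e {x..y} = \<dots>" .
  have "\<exists>l\<in>{x,y}. \<exists>r\<in>{x,y}. l \<le> n \<and> n \<le> r \<and> \<phi> n - chord \<phi> l r n \<le> e n" if n: "n \<in> {x..y}" for n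
  proof (cases "n = y")
    case True
    then show ?thesis by (auto simp: e_def)
  next
    case False
    have c: "chord \<phi> x y n = \<phi> x + k * (real_of_int n - real_of_int x)"
      using 0(4) pos by (simp add: chord_def)
    have "\<phi> n - chord \<phi> x y n \<le> H"
      unfolding H_def
    proof (rule harmonic_bound)
      show "\<phi> n - chord \<phi> x y n \<le> \<alpha> * (real_of_int n - real_of_int x)"
        using 0(5)[OF n] c by (simp add: algebra_simps)
      show "\<phi> n - chord \<phi> x y n \<le> \<beta> * (real_of_int y - real_of_int x - (real_of_int n - real_of_int x))"
        using 0(6)[OF n] 0(4) c by (simp add: algebra_simps)
    qed (use 0 n in auto)
    then show ?thesis using n False by (auto simp: e_def)
  qed
  then show ?case
    using 0 s H by (intro exI[of _ "{x,y}"] exI[of _ e]) (auto simp: e_def card_insert_if)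
next
  case (Suc d)
  define \<psi> where "\<psi> = (\<lambda>n. \<phi> n - \<phi> x - k * (real_of_int n - real_of_int x))"
  have "\<exists>p\<in>{x..y}. \<forall>n\<in>{x..y}. \<psi> n \<le> \<psi> p"
  proof -
    have "finite (\<psi> ` {x..y})" "\<psi> ` {x..y} \<noteq> {}" using Suc.prems by auto
    from Max_in[OF this] obtain p where "p \<in> {x..y}" "\<psi> p = Max (\<psi> ` {x..y})" by auto
    then show ?thesis by (intro bexI[of _ p]) auto
  qed
  then obtain p where p: "p \<in> {x..y}" and pmax: "\<And>n. n \<in> {x..y} \<Longrightarrow> \<psi> n \<le> \<psi> p" by blast
  define M where "M = \<psi> p"
  have \<psi>x: "\<psi> x = 0" and \<psi>y: "\<psi> y = 0" using Suc.prems(4) by (simp_all add: \<psi>_def)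
  have M0: "M \<ge> 0" using pmax[of x] \<psi>x Suc.prems by (simp add: M_def)
  have \<psi>1: "\<psi> n \<le> \<alpha> * (real_of_int n - real_of_int x)" if "n \<in> {x..y}" for n
    using Suc.prems(5)[OF that] by (simp add: \<psi>_def algebra_simps)
  have \<psi>2: "\<psi> n \<le> \<beta> * (real_of_int y - real_of_int n)" if "n \<in> {x..y}" for n
    using Suc.prems(6)[OF that] Suc.prems(4) by (simp add: \<psi>_def algebra_simps)
  show ?case
  proof (cases "M = 0")
    case True
    have pos: "real_of_int y - real_of_int x > 0" using Suc.prems by simp
    have c: "chord \<phi> x y n = \<phi> x + k * (real_of_int n - real_of_int x)" for n
      using Suc.prems(4) pos by (simp add: chord_def)
    have "\<phi> n - chord \<phi> x y n \<le> 0" if "n \<in> {x..y}" for n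
      using pmax[OF that] True c[of n] by (simp add: M_def \<psi>_def)
    then show ?thesis
      using Suc.prems by (intro exI[of _ "{x,y}"] exI[of _ "\<lambda>_. 0"]) (auto simp: card_insert_if)
  next
    case False
    then have M: "M > 0" using M0 by simp
    have px: "x < p" and py: "p < y" using p \<psi>x \<psi>y M unfolding M_def
      by (metis atLeastAtMost_iff less_irrefl order_le_less)+
    define L1 where "L1 = real_of_int p - real_of_int x"
    define L2 where "L2 = real_of_int y - real_of_int p"
    have L: "L1 > 0" "L2 > 0" "L1 + L2 = real_of_int y - real_of_int x"
      using px py by (simp_all add: L1_def L2_def)
    have M1: "M \<le> \<alpha> * L1" and M2: "M \<le> \<beta> * L2"
      using \<psi>1[OF p] \<psi>2[OF p] by (simp_all add: M_def L1_def L2_def)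
    have ab: "\<alpha> > 0" "\<beta> > 0"
      using M M1 M2 Suc.prems(2,3) by (auto simp: order_le_less)
    have \<phi>: "\<phi> n = \<psi> n + \<phi> x + k * (real_of_int n - real_of_int x)" for n
      by (simp add: \<psi>_def)
    have \<phi>p: "\<phi> p = M + \<phi> x + k * L1" using \<phi>[of p] by (simp add: M_def L1_def)
    have \<phi>y: "\<phi> y = \<phi> x + k * (L1 + L2)" using Suc.prems(4) L by simp
    \<comment> \<open>The left chord has slope \<open>k + M / L1\<close>. Relative to it the old
      left side has slope \<open>\<alpha> - M / L1\<close>, and the line of slope \<open>k\<close>
      through \<open>p\<close> has slope \<open>M / L1\<close>; these two add up to
      \<open>\<alpha>\<close>.\<close>
    have "\<exists>X e. X \<subseteq> {x..p} \<and> x \<in> X \<and> p \<in> X \<and> card X \<le> 2 ^ d + 1 \<and> (\<forall>n. 0 \<le> e n) \<and>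
      sum e {x..p} \<le> (\<alpha> - M / L1) * (M / L1) / ((\<alpha> - M / L1) + M / L1) *
         (real_of_int p - real_of_int x)\<^sup>2 / 4 ^ d \<and>
      (\<forall>n\<in>{x..p}. \<exists>l\<in>X. \<exists>r\<in>X. l \<le> n \<and> n \<le> r \<and> \<phi> n - chord \<phi> l r n \<le> e n)"
    proof (rule Suc.IH[where k = "k + M / L1"])
      show "0 \<le> \<alpha> - M / L1" using M1 L by (simp add: field_simps)
      show "\<phi> p - \<phi> x = (k + M / L1) * (real_of_int p - real_of_int x)"
        unfolding \<phi>p L1_def[symmetric] using L by (simp add: field_simps)
      fix n assume n: "n \<in> {x..p}"
      show "\<phi> n \<le> \<phi> x + (k + M / L1 + (\<alpha> - M / L1)) * (real_of_int n - real_of_int x)"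
        using Suc.prems(5)[of n] n py by simp
      have "\<psi> n \<le> M" using pmax[of n] n py by (simp add: M_def)
      then show "\<phi> n \<le> \<phi> p + (M / L1 - (k + M / L1)) * (real_of_int p - real_of_int n)"
        unfolding \<phi>[of n] \<phi>p by (simp add: L1_def algebra_simps)
    qed (use px M L in auto)
    then obtain X1 e1 where X1: "X1 \<subseteq> {x..p}" "x \<in> X1" "p \<in> X1" "card X1 \<le> 2 ^ d + 1"
      "\<And>n. 0 \<le> e1 n"
      "sum e1 {x..p} \<le> (\<alpha> - M / L1) * (M / L1) / ((\<alpha> - M / L1) + M / L1) * L1\<^sup>2 / 4 ^ d"
      "\<And>n. n \<in> {x..p} \<Longrightarrow> \<exists>l\<in>X1. \<exists>r\<in>X1. l \<le> n \<and> n \<le> r \<and> \<phi> n - chord \<phi> l r n \<le> e1 n"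
      unfolding L1_def by blast
    have "\<exists>X e. X \<subseteq> {p..y} \<and> p \<in> X \<and> y \<in> X \<and> card X \<le> 2 ^ d + 1 \<and> (\<forall>n. 0 \<le> e n) \<and>
      sum e {p..y} \<le> (M / L2) * (\<beta> - M / L2) / (M / L2 + (\<beta> - M / L2)) *
         (real_of_int y - real_of_int p)\<^sup>2 / 4 ^ d \<and>
      (\<forall>n\<in>{p..y}. \<exists>l\<in>X. \<exists>r\<in>X. l \<le> n \<and> n \<le> r \<and> \<phi> n - chord \<phi> l r n \<le> e n)"
    proof (rule Suc.IH[where k = "k - M / L2"])
      show "0 \<le> \<beta> - M / L2" using M2 L by (simp add: field_simps)
      show "\<phi> y - \<phi> p = (k - M / L2) * (real_of_int y - real_of_int p)"
        unfolding \<phi>p \<phi>y L2_def[symmetric] using L by (simp add: field_simps)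
      fix n assume n: "n \<in> {p..y}"
      have "\<psi> n \<le> M" using pmax[of n] n px by (simp add: M_def)
      then show "\<phi> n \<le> \<phi> p + (k - M / L2 + M / L2) * (real_of_int n - real_of_int p)"
        unfolding \<phi>[of n] \<phi>p by (simp add: L1_def algebra_simps)
      show "\<phi> n \<le> \<phi> y + (\<beta> - M / L2 - (k - M / L2)) * (real_of_int y - real_of_int n)"
        using Suc.prems(6)[of n] n px by simp
    qed (use py M L in auto)
    then obtain X2 e2 where X2: "X2 \<subseteq> {p..y}" "p \<in> X2" "y \<in> X2" "card X2 \<le> 2 ^ d + 1"
      "\<And>n. 0 \<le> e2 n"
      "sum e2 {p..y} \<le> (M / L2) * (\<beta> - M / L2) / (M / L2 + (\<beta> - M / L2)) * L2\<^sup>2 / 4 ^ d"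
      "\<And>n. n \<in> {p..y} \<Longrightarrow> \<exists>l\<in>X2. \<exists>r\<in>X2. l \<le> n \<and> n \<le> r \<and> \<phi> n - chord \<phi> l r n \<le> e2 n"
      unfolding L2_def by blast
    define e where "e = (\<lambda>n. if n \<le> p then e1 n else e2 n)"
    have fin: "finite X1" "finite X2" using X1(1) X2(1) finite_subset by blast+
    have "card (X1 \<union> X2) + card (X1 \<inter> X2) = card X1 + card X2" using fin card_Un_Int by metis
    moreover have "card (X1 \<inter> X2) \<ge> 1"
      using fin X1(3) X2(2) by (metis IntI One_nat_def Suc_leI card_gt_0_iff empty_iff finite_Int)
    ultimately have card: "card (X1 \<union> X2) \<le> 2 ^ Suc d + 1" using X1(4) X2(4) by simp
    have "{x..y} = {x..p} \<union> {p<..y}" using p by auto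
    then have "sum e {x..y} = sum e {x..p} + sum e {p<..y}"
      by (auto intro!: sum.union_disjoint)
    also have "sum e {x..p} = sum e1 {x..p}" by (intro sum.cong) (auto simp: e_def)
    also have "sum e {p<..y} = sum e2 {p<..y}" by (intro sum.cong) (auto simp: e_def)
    also have "sum e2 {p<..y} \<le> sum e2 {p..y}" using X2(5) by (intro sum_mono2) auto
    finally have "sum e {x..y} \<le> sum e1 {x..p} + sum e2 {p..y}" by simp
    also have "\<dots> \<le> ((\<alpha> - M / L1) * (M / L1) / ((\<alpha> - M / L1) + M / L1) * L1\<^sup>2 +
      (M / L2) * (\<beta> - M / L2) / (M / L2 + (\<beta> - M / L2)) * L2\<^sup>2) / 4 ^ d"
      using X1(6) X2(6) by (simp add: add_divide_distrib)
    also have "(\<alpha> - M / L1) * (M / L1) / ((\<alpha> - M / L1) + M / L1) * L1\<^sup>2 = M * L1 - M\<^sup>2 / \<alpha>"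
      using L ab by (simp add: field_simps power2_eq_square)
    also have "(M / L2) * (\<beta> - M / L2) / (M / L2 + (\<beta> - M / L2)) * L2\<^sup>2 = M * L2 - M\<^sup>2 / \<beta>"
      using L ab by (simp add: field_simps power2_eq_square)
    also have "(M * L1 - M\<^sup>2 / \<alpha> + (M * L2 - M\<^sup>2 / \<beta>)) / 4 ^ d
        \<le> \<alpha> * \<beta> / (\<alpha> + \<beta>) * (L1 + L2)\<^sup>2 / 4 / 4 ^ d"
      by (intro divide_right_mono triangle_split ab) simp
    also have "\<dots> = \<alpha> * \<beta> / (\<alpha> + \<beta>) * (real_of_int y - real_of_int x)\<^sup>2 / 4 ^ Suc d"
      unfolding L(3) by simp
    finally have se: "sum e {x..y} \<le> \<dots>" .
    have "\<exists>l\<in>X1 \<union> X2. \<exists>r\<in>X1 \<union> X2. l \<le> n \<and> n \<le> r \<and> \<phi> n - chord \<phi> l r n \<le> e n"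
      if n: "n \<in> {x..y}" for n
      using X1(7)[of n] X2(7)[of n] n by (cases "n \<le> p") (auto simp: e_def)
    moreover have "\<And>n. 0 \<le> e n" using X1(5) X2(5) by (simp add: e_def)
    moreover have "X1 \<union> X2 \<subseteq> {x..y}" using X1(1) X2(1) p by auto
    ultimately show ?thesis using X1(2) X2(3) card se
      by (intro exI[of _ "X1 \<union> X2"] exI[of _ e]) auto
  qed
qed

section \<open>Discrete concavity\<close>

text \<open>Increments are compared over arbitrary distances, as needed for translating a whole
  tail; \<open>discrete_concaveI\<close> recovers this form from second differences.\<close>

definition discrete_concave :: "int \<Rightarrow> int \<Rightarrow> (int \<Rightarrow> real) \<Rightarrow> bool" where
  "discrete_concave u v \<phi> \<longleftrightarrow>
     (\<forall>i j. u \<le> i \<and> i \<le> j \<and> j < v \<longrightarrow> \<phi> (j + 1) - \<phi> j \<le> \<phi> (i + 1) - \<phi> i)"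

lemma discrete_concave_subset:
  "discrete_concave u v \<phi> \<Longrightarrow> u \<le> u' \<Longrightarrow> v' \<le> v \<Longrightarrow> discrete_concave u' v' \<phi>"
  unfolding discrete_concave_def by (meson order_trans order_less_le_trans)

lemma discrete_concaveI:
  assumes "\<And>n. u < n \<Longrightarrow> n < v \<Longrightarrow> \<phi> (n - 1) + \<phi> (n + 1) \<le> 2 * \<phi> n"
  shows "discrete_concave u v \<phi>"
  unfolding discrete_concave_def
proof (intro allI impI, elim conjE)
  fix i j assume "u \<le> i" "i \<le> j" "j < v"
  from this(2,1,3) show "\<phi> (j + 1) - \<phi> j \<le> \<phi> (i + 1) - \<phi> i"
  proof (induction j rule: int_ge_induct)
    case (step j)
    then show ?case using assms[of "j + 1"] by (simp add: add.commute)
  qed simp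
qed

lemma discrete_concave_reflect:
  assumes "discrete_concave u v \<phi>"
  shows "discrete_concave (- v) (- u) (\<lambda>n. \<phi> (- n))"
proof (rule discrete_concaveI)
  fix n assume "- v < n" "n < - u"
  then have "\<phi> (- n + 1) - \<phi> (- n) \<le> \<phi> (- n - 1 + 1) - \<phi> (- n - 1)"
    using assms[unfolded discrete_concave_def, rule_format, of "- n - 1" "- n"] by linarith
  moreover have "- (n - 1) = - n + 1" "- (n + 1) = - n - 1" by auto
  ultimately show "\<phi> (- (n - 1)) + \<phi> (- (n + 1)) \<le> 2 * \<phi> (- n)" by simp
qed

lemma discrete_concave_supergradient:
  assumes "discrete_concave u v \<phi>" "u \<le> j" "j < v" "m \<in> {u..v}"
  shows "\<phi> m \<le> \<phi> j + (\<phi> (j + 1) - \<phi> j) * (real_of_int m - real_of_int j)"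
proof (cases "j \<le> m")
  case True
  then show ?thesis using assms(4)
  proof (induction m rule: int_ge_induct)
    case (step m)
    have "\<phi> (m + 1) - \<phi> m \<le> \<phi> (j + 1) - \<phi> j"
      using assms(1)[unfolded discrete_concave_def, rule_format, of j m] assms(2) step by simp
    moreover have "\<phi> m \<le> \<phi> j + (\<phi> (j + 1) - \<phi> j) * (real_of_int m - real_of_int j)"
      using step assms(2) by simp
    ultimately show ?case by (simp add: algebra_simps)
  qed simp
next
  case False
  then have "m \<le> j" by simp
  then show ?thesis using assms(4)
  proof (induction m rule: int_le_induct)
    case (step m)
    have "\<phi> (j + 1) - \<phi> j \<le> \<phi> (m - 1 + 1) - \<phi> (m - 1)"
      using assms(1)[unfolded discrete_concave_def, rule_format, of "m - 1" j] assms(2,3) step by simp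
    moreover have "\<phi> m \<le> \<phi> j + (\<phi> (j + 1) - \<phi> j) * (real_of_int m - real_of_int j)"
      using step assms(3) by simp
    ultimately show ?case by (simp add: algebra_simps)
  qed simp
qed

text \<open>The supergradient at \<open>n\<close>, evaluated at \<open>l\<close> and
  \<open>r\<close> and averaged with the weights of \<open>n\<close>, returns
  \<open>\<phi> n\<close>. Its slope is the increment from \<open>n\<close> to \<open>n + 1\<close>,
  which may leave the range if \<open>n = r\<close>; hence the case distinction.\<close>

lemma discrete_concave_ge_chord:
  assumes c: "discrete_concave u v \<phi>" and "u \<le> l" "l \<le> n" "n \<le> r" "r \<le> v"
  shows "chord \<phi> l r n \<le> \<phi> n"
proof (cases "n = r")
  case True
  then show ?thesis by (simp add: chord_def)
next
  case False
  then obtain w where w: "0 \<le> w" "w \<le> 1"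
    "real_of_int n = (1 - w) * real_of_int l + w * real_of_int r"
    "chord \<phi> l r n = (1 - w) * \<phi> l + w * \<phi> r"
    using chord_convex_combination[of l r n] assms by (metis order_le_less order_le_less_trans)
  define s where "s = \<phi> (n + 1) - \<phi> n"
  have "\<phi> l \<le> \<phi> n + s * (real_of_int l - real_of_int n)"
    "\<phi> r \<le> \<phi> n + s * (real_of_int r - real_of_int n)"
    unfolding s_def using assms False by (auto intro!: discrete_concave_supergradient[OF c])
  then have "(1 - w) * \<phi> l + w * \<phi> r \<le>
     (1 - w) * (\<phi> n + s * (real_of_int l - real_of_int n)) + w * (\<phi> n + s * (real_of_int r - real_of_int n))"
    using w by (intro add_mono mult_left_mono) auto
  also have "\<dots> = \<phi> n + s * ((1 - w) * real_of_int l + w * real_of_int r - real_of_int n)"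
    by (simp add: algebra_simps)
  finally show ?thesis using w by simp
qed

text \<open>The outer chord is affine and lies below \<open>\<phi>\<close> at \<open>l\<close> and
  \<open>r\<close>. This transfers an error bound for a chord between nodes of one family to the
  shorter chord between neighbours in a larger set of nodes.\<close>

lemma discrete_concave_chord_refine:
  assumes c: "discrete_concave u v \<phi>" "u \<le> l'" "l' \<le> l" "l < r" "r \<le> r'" "r' \<le> v" "l \<le> n" "n \<le> r"
  shows "chord \<phi> l' r' n \<le> chord \<phi> l r n"
proof -
  define B where "B = (\<phi> r' - \<phi> l') / (real_of_int r' - real_of_int l')"
  define A where "A = \<phi> l' - B * real_of_int l'"
  have AB: "chord \<phi> l' r' m = A + B * real_of_int m" for m
    unfolding chord_def A_def B_def[symmetric] by (simp add: algebra_simps)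
  obtain w where w: "0 \<le> w" "w \<le> 1"
    "real_of_int n = (1 - w) * real_of_int l + w * real_of_int r"
    "chord \<phi> l r n = (1 - w) * \<phi> l + w * \<phi> r"
    using chord_convex_combination[of l r n] assms by metis
  have "chord \<phi> l' r' l \<le> \<phi> l" "chord \<phi> l' r' r \<le> \<phi> r"
    using assms by (auto intro!: discrete_concave_ge_chord[OF c(1)])
  then have "(1 - w) * (A + B * real_of_int l) + w * (A + B * real_of_int r) \<le> chord \<phi> l r n"
    unfolding w(4) AB using w by (intro add_mono mult_left_mono) auto
  then show ?thesis unfolding AB w(3) by (simp add: algebra_simps)
qed

text \<open>The points are grouped by the integer part of their drop from \<open>\<phi> a\<close> in
  units of \<open>\<eta>\<close>, which gives at most \<open>K + 1\<close> groups. Both ends of each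
  group become nodes: one integer step may drop by far more than \<open>\<eta>\<close>, and no
  bracketing pair may straddle such a jump.\<close>

lemma drop_nodes:
  fixes \<phi> :: "int \<Rightarrow> real"
  assumes mono: "\<And>i j. a \<le> i \<Longrightarrow> i \<le> j \<Longrightarrow> j \<le> b \<Longrightarrow> \<phi> j \<le> \<phi> i"
    and drop: "\<phi> a - \<phi> b \<le> \<eta> * real K" and "\<eta> > 0"
  shows "\<exists>X. X \<subseteq> {a..b} \<and> card X \<le> 2 * (K + 1) \<and>
    (\<forall>n\<in>{a..b}. \<exists>l\<in>X. \<exists>r\<in>X. l \<le> n \<and> n \<le> r \<and> \<phi> l - \<phi> r \<le> \<eta>)"
proof -
  define c where "c = (\<lambda>n. nat \<lfloor>(\<phi> a - \<phi> n) / \<eta>\<rfloor>)"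
  define S where "S = (\<lambda>j. {n\<in>{a..b}. c n = j})"
  define J where "J = c ` {a..b}"
  have fin: "finite (S j)" for j unfolding S_def by (rule finite_Collect_conjI) simp
  have ne: "S j \<noteq> {}" if "j \<in> J" for j using that by (auto simp: S_def J_def)
  have c_le: "c n \<le> K" if "n \<in> {a..b}" for n
  proof -
    have "(\<phi> a - \<phi> n) / \<eta> \<le> real K" using mono[of n b] that drop \<open>\<eta> > 0\<close> by (simp add: field_simps)
    then show ?thesis unfolding c_def by linarith
  qed
  then have "J \<subseteq> {..K}" by (auto simp: J_def)
  then have J: "finite J" "card J \<le> K + 1" using card_mono[of "{..K}" J] finite_subset by auto
  define X where "X = (\<lambda>j. Min (S j)) ` J \<union> (\<lambda>j. Max (S j)) ` J"
  have "card X \<le> card ((\<lambda>j. Min (S j)) ` J) + card ((\<lambda>j. Max (S j)) ` J)"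
    unfolding X_def by (rule card_Un_le)
  also have "\<dots> \<le> 2 * (K + 1)"
    using J card_image_le[OF J(1), of "\<lambda>j. Min (S j)"] card_image_le[OF J(1), of "\<lambda>j. Max (S j)"] by simp
  finally have card: "card X \<le> 2 * (K + 1)" .
  have inS: "Min (S j) \<in> S j" "Max (S j) \<in> S j" if "j \<in> J" for j
    using Min_in[OF fin ne] Max_in[OF fin ne] that by auto
  have "X \<subseteq> {a..b}" using inS by (force simp: X_def S_def)
  moreover have "\<exists>l\<in>X. \<exists>r\<in>X. l \<le> n \<and> n \<le> r \<and> \<phi> l - \<phi> r \<le> \<eta>" if n: "n \<in> {a..b}" for n
  proof -
    define l where "l = Min (S (c n))"
    define r where "r = Max (S (c n))"
    have j: "c n \<in> J" using n by (simp add: J_def)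
    have nS: "n \<in> S (c n)" using n by (simp add: S_def)
    have "l \<in> X" "r \<in> X" using j by (auto simp: X_def l_def r_def)
    moreover have "l \<le> n" "n \<le> r" using nS fin by (simp_all add: l_def r_def)
    moreover have lr: "c l = c n" "c r = c n" "l \<in> {a..b}" "r \<in> {a..b}" using inS[OF j] by (auto simp: l_def r_def S_def)
    moreover have "0 \<le> (\<phi> a - \<phi> l) / \<eta>" "0 \<le> (\<phi> a - \<phi> r) / \<eta>"
      using mono[of a l] mono[of a r] lr \<open>\<eta> > 0\<close> by auto
    then have "(\<phi> a - \<phi> r) / \<eta> - (\<phi> a - \<phi> l) / \<eta> \<le> 1"
      using lr(1,2) unfolding c_def by linarith
    then have "(\<phi> l - \<phi> r) / \<eta> \<le> 1" by (simp add: diff_divide_distrib)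
    then have "\<phi> l - \<phi> r \<le> \<eta>" using \<open>\<eta> > 0\<close> by (simp add: divide_le_eq)
    ultimately show ?thesis by blast
  qed
  ultimately show ?thesis using card by blast
qed

text \<open>The cost of exchanging the chord of the exponent for the chord of the exponential is
  quadratic in the drop \<open>D\<close>, so drops of order \<open>1 / 2 ^ d\<close> cost order
  \<open>1 / 4 ^ d\<close>. The first part is convexity. The second combines
  \<open>exp (- D) \<le> 1 - D + D\<^sup>2 / 2\<close>, where the cubic Taylor remainder is
  nonpositive, with the tangent bound for \<open>exp (- (w * D))\<close>.\<close>

lemma exp_chord_error:
  fixes A D w :: real
  assumes "0 \<le> D" "0 \<le> w" "w \<le> 1"
  shows "exp (A - w * D) \<le> (1 - w) * exp A + w * exp (A - D)"
    and "(1 - w) * exp A + w * exp (A - D) \<le> exp (A - w * D) + exp A * (D\<^sup>2 / 2)"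
proof -
  have "convex_on UNIV (exp :: real \<Rightarrow> real)" by (rule exp_convex)
  from convex_onD[OF this, of w A "A - D"] assms
  show "exp (A - w * D) \<le> (1 - w) * exp A + w * exp (A - D)" by (simp add: algebra_simps)
  have "exp (- D) \<le> 1 - D + D\<^sup>2 / 2"
  proof (cases "D = 0")
    case False
    have "\<exists>t. \<bar>t\<bar> \<le> \<bar>- D\<bar> \<and> exp (- D) = (\<Sum>m<3. (- D) ^ m / fact m) + exp t / fact 3 * (- D) ^ 3"
      by (rule Maclaurin_exp_le)
    then obtain t where "exp (- D) = (\<Sum>m<3. (- D) ^ m / fact m) + exp t / fact 3 * (- D) ^ 3" by blast
    moreover have "exp t / fact 3 * (- D) ^ 3 \<le> 0"
      using assms by (simp add: mult_nonneg_nonpos)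
    ultimately show ?thesis by (simp add: eval_nat_numeral)
  qed simp
  moreover have "1 - w * D \<le> exp (- (w * D))" using exp_ge_add_one_self[of "- (w * D)"] by simp
  moreover have "w * exp (- D) \<le> w * (1 - D + D\<^sup>2 / 2)"
    using calculation(1) assms by (intro mult_left_mono)
  moreover have "w * (D\<^sup>2 / 2) \<le> D\<^sup>2 / 2" using assms by (simp add: mult_left_le_one_le)
  ultimately have "(1 - w) + w * exp (- D) \<le> exp (- (w * D)) + D\<^sup>2 / 2" by (simp add: algebra_simps)
  then have "exp A * ((1 - w) + w * exp (- D)) \<le> exp A * (exp (- (w * D)) + D\<^sup>2 / 2)" by simp
  then show "(1 - w) * exp A + w * exp (A - D) \<le> exp (A - w * D) + exp A * (D\<^sup>2 / 2)"
    by (simp add: exp_diff exp_minus field_simps)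
qed

section \<open>Piecewise affine functions through monotone labels\<close>

text \<open>
  Indexing the pieces by a monotone label on the whole domain makes concatenation, reflection and
  pulling back along a monotone map (such as the floor function of a grid) immediate; the blocks of
  the partition are the fibres of the label.
\<close>

definition labelled_affine :: "('a::linorder \<Rightarrow> real) \<Rightarrow> nat \<Rightarrow> ('a \<Rightarrow> real) \<Rightarrow> bool" where
  "labelled_affine \<iota> K h \<longleftrightarrow>
     (\<exists>c p q. mono c \<and> (\<forall>x. c x < K) \<and> (\<forall>x. h x = p (c x) * \<iota> x + q (c x)))"

text \<open>Coefficients may be given pointwise if they are constant on the fibres of the label; a
  representative of each fibre then turns them into functions of the label.\<close>

lemma labelled_affineI:
  fixes c :: "'a::linorder \<Rightarrow> nat"
  assumes "mono c" "\<And>x. c x < K" "\<And>x y. c x = c y \<Longrightarrow> P x = P y \<and> Q x = Q y"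
    "\<And>x. h x = P x * \<iota> x + Q x"
  shows "labelled_affine \<iota> K h"
proof -
  define s where "s = (\<lambda>j. SOME x. c x = j)"
  have "c (s (c x)) = c x" for x unfolding s_def by (rule someI[of _ x]) simp
  then have "P (s (c x)) = P x" "Q (s (c x)) = Q x" for x using assms(3) by blast+
  then have "\<forall>x. h x = (\<lambda>j. P (s j)) (c x) * \<iota> x + (\<lambda>j. Q (s j)) (c x)" using assms(4) by simp
  then show ?thesis unfolding labelled_affine_def using assms(1,2)
    by (intro exI[of _ c] exI[of _ "\<lambda>j. P (s j)"] exI[of _ "\<lambda>j. Q (s j)"]) simp
qed

lemma labelled_affine_mono: "labelled_affine \<iota> K h \<Longrightarrow> K \<le> K' \<Longrightarrow> labelled_affine \<iota> K' h"
  unfolding labelled_affine_def by (meson order_less_le_trans)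

lemma labelled_affine_const: "labelled_affine \<iota> 1 (\<lambda>_. k)"
  by (rule labelled_affineI[where c = "\<lambda>_. 0" and P = "\<lambda>_. 0" and Q = "\<lambda>_. k"]) (auto simp: mono_def)

lemma labelled_affine_If:
  assumes "labelled_affine \<iota> K1 h1" "labelled_affine \<iota> K2 h2"
  shows "labelled_affine \<iota> (K1 + K2) (\<lambda>x. if x < t then h1 x else h2 x)"
proof -
  obtain c1 p1 q1 where 1: "mono c1" "\<And>x. c1 x < K1" "\<And>x. h1 x = p1 (c1 x) * \<iota> x + q1 (c1 x)"
    using assms(1) unfolding labelled_affine_def by blast
  obtain c2 p2 q2 where 2: "mono c2" "\<And>x. c2 x < K2" "\<And>x. h2 x = p2 (c2 x) * \<iota> x + q2 (c2 x)"
    using assms(2) unfolding labelled_affine_def by blast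
  have ne: "c1 x \<noteq> K1 + j" for x j using 1(2)[of x] by simp
  show ?thesis
  proof (rule labelled_affineI[where c = "\<lambda>x. if x < t then c1 x else K1 + c2 x"
        and P = "\<lambda>x. if x < t then p1 (c1 x) else p2 (c2 x)"
        and Q = "\<lambda>x. if x < t then q1 (c1 x) else q2 (c2 x)"])
    show "mono (\<lambda>x. if x < t then c1 x else K1 + c2 x)"
      using 1(1,2) 2(1) by (auto simp: mono_def less_imp_le trans_le_add1)
    show "(if x < t then c1 x else K1 + c2 x) < K1 + K2" for x
      using 1(2)[of x] 2(2)[of x] by auto
  qed (use 1 2 ne ne[symmetric] in \<open>auto split: if_splits\<close>)
qed

lemma labelled_affine_reflect:
  assumes "labelled_affine real_of_int K h"
  shows "labelled_affine real_of_int K (\<lambda>n. h (- n))"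
proof -
  obtain c p q where c: "mono c" "\<And>x. c x < K" "\<And>x. h x = p (c x) * real_of_int x + q (c x)"
    using assms unfolding labelled_affine_def by blast
  show ?thesis
  proof (rule labelled_affineI[where c = "\<lambda>n. K - 1 - c (- n)" and P = "\<lambda>n. - p (c (- n))"
        and Q = "\<lambda>n. q (c (- n))"])
    show "mono (\<lambda>n. K - 1 - c (- n))"
      using c(1) by (auto simp: mono_def intro!: diff_le_mono2)
    show "K - 1 - c (- n) < K" for n using c(2)[of "- n"] by simp
    fix x y assume "K - 1 - c (- x) = K - 1 - c (- y)"
    then have "c (- x) = c (- y)" using c(2)[of "- x"] c(2)[of "- y"] by simp
    then show "- p (c (- x)) = - p (c (- y)) \<and> q (c (- x)) = q (c (- y))" by simp
  qed (simp add: c(3))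
qed

text \<open>The label of \<open>n\<close> is the number of nodes up to \<open>n\<close>. The sets
  \<open>A n\<close> form a chain, so this number determines \<open>A n\<close> and with it both
  neighbouring nodes. Outside the hull of the nodes \<open>Max {}\<close> or \<open>Min {}\<close>
  occurs: unspecified, but still a function of the label. At the last node the value is correct all
  the same, because \<open>chord f l r l = f l\<close> for every \<open>r\<close>.\<close>

lemma interpolation:
  fixes f :: "int \<Rightarrow> real"
  assumes fin: "finite X"
  shows "\<exists>h. labelled_affine real_of_int (card X + 1) h \<and> (\<forall>n\<in>X. h n = f n) \<and>
    (\<forall>n. n \<notin> X \<and> (\<exists>z\<in>X. z < n) \<and> (\<exists>z\<in>X. n < z) \<longrightarrow>
      (\<exists>l\<in>X. \<exists>r\<in>X. l < n \<and> n < r \<and> (\<forall>z\<in>X. z \<le> l \<or> r \<le> z) \<and> h n = chord f l r n))"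
proof -
  define A where "A = (\<lambda>n. {z\<in>X. z \<le> n})"
  define l where "l = (\<lambda>n. Max (A n))"
  define r where "r = (\<lambda>n. Min (X - A n))"
  define P where "P = (\<lambda>n. (f (r n) - f (l n)) / (real_of_int (r n) - real_of_int (l n)))"
  define h where "h = (\<lambda>n. chord f (l n) (r n) n)"
  have finA: "finite (A n)" for n using fin by (simp add: A_def)
  have A_mono: "m \<le> n \<Longrightarrow> A m \<subseteq> A n" for m n by (auto simp: A_def)
  have A_eq: "A m = A n" if "card (A m) = card (A n)" for m n
    using that A_mono[of m n] A_mono[of n m] card_subset_eq[OF finA] by (metis linear)
  have "labelled_affine real_of_int (card X + 1) h"
  proof (rule labelled_affineI[where c = "\<lambda>n. card (A n)" and P = P and Q = "\<lambda>n. f (l n) - P n * real_of_int (l n)"])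
    show "mono (\<lambda>n. card (A n))" using A_mono finA by (auto simp: mono_def intro!: card_mono)
    show "card (A n) < card X + 1" for n using card_mono[OF fin, of "A n"] by (auto simp: A_def)
    show "P m = P n \<and> f (l m) - P m * real_of_int (l m) = f (l n) - P n * real_of_int (l n)"
      if "card (A m) = card (A n)" for m n
      using A_eq[OF that] by (simp add: P_def l_def r_def)
    show "h n = P n * real_of_int n + (f (l n) - P n * real_of_int (l n))" for n
      by (simp only: h_def chord_def P_def[THEN fun_cong, symmetric]) (simp add: algebra_simps)
  qed
  moreover have "h n = f n" if "n \<in> X" for n
  proof -
    have "l n = n" unfolding l_def using that by (intro Max_eqI finA) (auto simp: A_def)
    then show ?thesis by (simp add: h_def)
  qed
  moreover have "\<exists>l\<in>X. \<exists>r\<in>X. l < n \<and> n < r \<and> (\<forall>z\<in>X. z \<le> l \<or> r \<le> z) \<and> h n = chord f l r n"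
    if n: "n \<notin> X" "\<exists>z\<in>X. z < n" "\<exists>z\<in>X. n < z" for n
  proof -
    have 1: "A n \<noteq> {}" "X - A n \<noteq> {}" using n by (auto simp: A_def less_imp_le)
    have "l n \<in> A n" "r n \<in> X - A n"
      unfolding l_def r_def using Max_in[OF finA 1(1)] Min_in[OF _ 1(2)] fin by auto
    then have "l n \<in> X" "r n \<in> X" "l n < n" "n < r n" using n by (auto simp: A_def order_le_less)
    moreover have "z \<le> l n \<or> r n \<le> z" if "z \<in> X" for z
      using that Max_ge[OF finA, of z n] Min_le[of "X - A n" z] fin
      unfolding l_def r_def by blast
    ultimately show ?thesis using h_def by blast
  qed
  ultimately show ?thesis by blast
qed

text \<open>The interpolant of \<open>f\<close> at the union of the two node families is compared
  with \<open>f\<close> through the exponential of the chord of \<open>\<phi> = ln f\<close>, which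
  lies below both. The triangle nodes control its distance to \<open>f\<close>, the drop nodes its
  distance to the interpolant.\<close>

lemma level_approximation:
  fixes f :: "int \<Rightarrow> real"
  assumes "a \<le> b" and pos: "\<And>n. n \<in> {a..b} \<Longrightarrow> 0 < f n"
    and conc: "discrete_concave a b (\<lambda>n. ln (f n))"
    and mono: "\<And>i j. a \<le> i \<Longrightarrow> i \<le> j \<Longrightarrow> j \<le> b \<Longrightarrow> f j \<le> f i"
    and level: "f a / 8 \<le> f b"
  shows "\<exists>h. labelled_affine real_of_int (7 * 2 ^ d) h \<and> (\<forall>n\<in>{a..b}. 0 \<le> h n \<and> h n \<le> f a) \<and>
    (\<Sum>n\<in>{a..b}. \<bar>f n - h n\<bar>) \<le> 8 * f a * (real_of_int b - real_of_int a) / 4 ^ d"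
proof (cases "a = b")
  case True
  have "labelled_affine real_of_int (7 * 2 ^ d) (\<lambda>_. f a)"
    by (rule labelled_affine_mono[OF labelled_affine_const]) (simp add: Suc_leI)
  then show ?thesis using True pos[of a] by (intro exI[of _ "\<lambda>_. f a"]) auto
next
  case False
  then have ab: "a < b" using assms(1) by simp
  define \<phi> where "\<phi> = (\<lambda>n. ln (f n))"
  define \<eta> :: real where "\<eta> = 3 / 2 ^ d"
  have f\<phi>: "f n = exp (\<phi> n)" if "n \<in> {a..b}" for n using pos[OF that] by (simp add: \<phi>_def)
  have \<phi>_mono: "\<phi> j \<le> \<phi> i" if "a \<le> i" "i \<le> j" "j \<le> b" for i j
    using mono[OF that] pos[of i] pos[of j] that by (simp add: \<phi>_def)
  have ln8: "\<phi> a - \<phi> b \<le> 3"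
  proof -
    have "(8::real) \<le> exp 3"
    proof -
      have "(2::real) \<le> exp 1" using exp_ge_add_one_self[of 1] by simp
      then have "2 ^ 3 \<le> (exp 1 :: real) ^ 3" by (intro power_mono) auto
      then show ?thesis by (simp flip: exp_of_nat_mult)
    qed
    then have "8 * f b \<le> exp 3 * f b" using pos[of b] ab by (intro mult_right_mono) auto
    then have "f a \<le> exp 3 * f b" using level by simp
    then have "exp (\<phi> a) \<le> exp (3 + \<phi> b)" using ab by (simp add: f\<phi> exp_add)
    then show ?thesis by simp
  qed
  define L where "L = real_of_int b - real_of_int a"
  have L: "L > 0" using ab by (simp add: L_def)
  define D where "D = \<phi> a - \<phi> b"
  have D: "D \<ge> 0" using \<phi>_mono[of a b] ab by (simp add: D_def)
  \<comment> \<open>The starting triangle has a horizontal left side, as \<open>\<phi>\<close>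
    decreases. For the right side the slope \<open>D\<close> beyond that of the chord suffices:
    every integer \<open>n < b\<close> has distance at least 1 from \<open>b\<close>, so this side
    already exceeds \<open>\<phi> a\<close> there. Twice the area is then at most
    \<open>D * L \<le> 3 * L\<close>.\<close>
  have "\<exists>X e. X \<subseteq> {a..b} \<and> a \<in> X \<and> b \<in> X \<and> card X \<le> 2 ^ d + 1 \<and> (\<forall>n. 0 \<le> e n) \<and>
    sum e {a..b} \<le> (D / L) * D / (D / L + D) * (real_of_int b - real_of_int a)\<^sup>2 / 4 ^ d \<and>
    (\<forall>n\<in>{a..b}. \<exists>l\<in>X. \<exists>r\<in>X. l \<le> n \<and> n \<le> r \<and> \<phi> n - chord \<phi> l r n \<le> e n)"
  proof (rule triangle_nodes[where k = "- (D / L)"])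
    show "\<phi> b - \<phi> a = - (D / L) * (real_of_int b - real_of_int a)"
      unfolding L_def[symmetric] using L by (simp add: D_def)
    fix n assume n: "n \<in> {a..b}"
    show "\<phi> n \<le> \<phi> a + (- (D / L) + D / L) * (real_of_int n - real_of_int a)"
      using \<phi>_mono[of a n] n by simp
    show "\<phi> n \<le> \<phi> b + (D - - (D / L)) * (real_of_int b - real_of_int n)"
    proof (cases "n = b")
      case False
      then have "1 \<le> real_of_int b - real_of_int n" using n by simp
      then have "D * 1 \<le> (D + D / L) * (real_of_int b - real_of_int n)"
        using D L by (intro mult_mono) auto
      then show ?thesis using \<phi>_mono[of a n] n by (simp add: D_def)
    qed simp
  qed (use ab D L in auto)
  then obtain X1 e where X1: "X1 \<subseteq> {a..b}" "a \<in> X1" "b \<in> X1" "card X1 \<le> 2 ^ d + 1" "\<And>n. 0 \<le> e n"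
    "sum e {a..b} \<le> (D / L) * D / (D / L + D) * L\<^sup>2 / 4 ^ d"
    "\<And>n. n \<in> {a..b} \<Longrightarrow> \<exists>l\<in>X1. \<exists>r\<in>X1. l \<le> n \<and> n \<le> r \<and> \<phi> n - chord \<phi> l r n \<le> e n"
    unfolding L_def by blast
  have "(D / L) * D / (D / L + D) \<le> D / L"
  proof -
    have "D \<le> D / L + D" "0 \<le> D / L + D" using D L by auto
    then have "D / (D / L + D) \<le> 1" by (auto simp: divide_le_eq_1)
    then have "D / L * (D / (D / L + D)) \<le> D / L * 1" using D L by (intro mult_left_mono) auto
    then show ?thesis by simp
  qed
  then have "(D / L) * D / (D / L + D) * L\<^sup>2 \<le> D / L * L\<^sup>2" by (intro mult_right_mono) auto
  also have "\<dots> \<le> 3 * L" using L ln8 by (simp add: power2_eq_square D_def)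
  finally have se: "sum e {a..b} \<le> 3 * L / 4 ^ d"
    using X1(6) by (meson divide_right_mono order_trans zero_le_numeral zero_le_power)
  have "\<exists>X. X \<subseteq> {a..b} \<and> card X \<le> 2 * (2 ^ d + 1) \<and>
    (\<forall>n\<in>{a..b}. \<exists>l\<in>X. \<exists>r\<in>X. l \<le> n \<and> n \<le> r \<and> \<phi> l - \<phi> r \<le> \<eta>)"
    by (rule drop_nodes[where b = b]) (use \<phi>_mono ln8 in \<open>auto simp: \<eta>_def\<close>)
  then obtain X2 where X2: "X2 \<subseteq> {a..b}" "card X2 \<le> 2 * (2 ^ d + 1)"
    "\<And>n. n \<in> {a..b} \<Longrightarrow> \<exists>l\<in>X2. \<exists>r\<in>X2. l \<le> n \<and> n \<le> r \<and> \<phi> l - \<phi> r \<le> \<eta>" by blast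
  define X where "X = X1 \<union> X2"
  have X: "finite X" "X \<subseteq> {a..b}" "a \<in> X" "b \<in> X"
    using X1(1-3) X2(1) finite_subset[of X "{a..b}"] by (auto simp: X_def)
  \<comment> \<open>With \<open>t = 2 ^ d\<close> the two families have at most
    \<open>3 * t + 3\<close> nodes, and interpolation needs one more label.\<close>
  have "card X + 1 \<le> 7 * t" if "1 \<le> t" "card X1 \<le> t + 1" "card X2 \<le> 2 * (t + 1)" for t
    using that card_Un_le[of X1 X2] unfolding X_def by simp
  then have card: "card X + 1 \<le> 7 * 2 ^ d" using X1(4) X2(2) by simp
  obtain h where h: "labelled_affine real_of_int (card X + 1) h" "\<forall>n\<in>X. h n = f n"
    "\<forall>n. n \<notin> X \<and> (\<exists>z\<in>X. z < n) \<and> (\<exists>z\<in>X. n < z) \<longrightarrow>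
      (\<exists>l\<in>X. \<exists>r\<in>X. l < n \<and> n < r \<and> (\<forall>z\<in>X. z \<le> l \<or> r \<le> z) \<and> h n = chord f l r n)"
    using interpolation[OF X(1), of f] by (elim exE conjE)
  note h = h(1) h(2)[rule_format] h(3)[rule_format]
  have main: "0 \<le> h n \<and> h n \<le> f a \<and> \<bar>f n - h n\<bar> \<le> f a * (e n + \<eta>\<^sup>2 / 2)"
    if n: "n \<in> {a..b}" "n \<notin> X" for n
  proof -
    have "a < n" "n < b" using n X by (auto simp: order_le_less)
    then have "n \<notin> X \<and> (\<exists>z\<in>X. z < n) \<and> (\<exists>z\<in>X. n < z)" using n(2) X(3,4) by blast
    from h(3)[OF this] obtain l r where lr: "l \<in> X" "r \<in> X" "l < n" "n < r"
      "\<And>z. z \<in> X \<Longrightarrow> z \<le> l \<or> r \<le> z" "h n = chord f l r n" by blast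
    have lr': "a \<le> l" "r \<le> b" using lr X by auto
    have lr_ab: "l \<in> {a..b}" "r \<in> {a..b}" using lr X by auto
    obtain l1 r1 where 1: "l1 \<in> X1" "r1 \<in> X1" "l1 \<le> n" "n \<le> r1" "\<phi> n - chord \<phi> l1 r1 n \<le> e n"
      using X1(7)[OF n(1)] by blast
    \<comment> \<open>As \<open>n\<close> is not a node and \<open>l\<close>, \<open>r\<close> are
      consecutive nodes around it, any pair of nodes bracketing \<open>n\<close> also encloses
      \<open>l\<close> and \<open>r\<close>.\<close>
    have X1_lr: "l1 \<le> l" "r \<le> r1" "a \<le> l1" "r1 \<le> b" using lr(3,4) lr(5)[of l1] lr(5)[of r1] 1 X1(1) n(2)
      unfolding X_def by fastforce+
    obtain l2 r2 where 2: "l2 \<in> X2" "r2 \<in> X2" "l2 \<le> n" "n \<le> r2" "\<phi> l2 - \<phi> r2 \<le> \<eta>"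
      using X2(3)[OF n(1)] by blast
    have X2_lr: "l2 \<le> l" "r \<le> r2" "a \<le> l2" "r2 \<le> b" using lr(3,4) lr(5)[of l2] lr(5)[of r2] 2 X2(1) n(2)
      unfolding X_def by fastforce+
    have Dlr: "0 \<le> \<phi> l - \<phi> r" "\<phi> l - \<phi> r \<le> \<eta>"
      using \<phi>_mono[of l r] \<phi>_mono[of l2 l] \<phi>_mono[of r r2] 2 X2_lr lr lr' by auto
    have conc': "discrete_concave a b \<phi>" using conc by (simp add: \<phi>_def)
    obtain w where w: "0 \<le> w" "w \<le> 1" "\<And>\<phi>. chord \<phi> l r n = (1 - w) * \<phi> l + w * \<phi> r"
      using chord_convex_combination[of l r n] lr by (metis less_imp_le less_trans)
    define E where "E = exp (chord \<phi> l r n)"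
    have ch: "chord \<phi> l r n = \<phi> l - w * (\<phi> l - \<phi> r)" unfolding w(3) by (simp add: algebra_simps)
    have hn: "h n = (1 - w) * exp (\<phi> l) + w * exp (\<phi> l - (\<phi> l - \<phi> r))"
      using lr_ab by (simp add: lr(6) w(3) f\<phi>)
    have hE: "E \<le> h n" "h n \<le> E + exp (\<phi> l) * ((\<phi> l - \<phi> r)\<^sup>2 / 2)"
      unfolding E_def ch hn by (rule exp_chord_error[OF Dlr(1) w(1,2)])+
    have fl: "f l \<le> f a" "f r \<le> f a" "f n \<le> f a" using mono lr_ab n by auto
    have "(\<phi> l - \<phi> r)\<^sup>2 \<le> \<eta>\<^sup>2" using Dlr by (intro power_mono) auto
    then have "exp (\<phi> l) * ((\<phi> l - \<phi> r)\<^sup>2 / 2) \<le> f a * (\<eta>\<^sup>2 / 2)"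
      using fl lr_ab pos[of a] ab by (intro mult_mono) (auto simp: f\<phi>)
    then have hE': "h n \<le> E + f a * (\<eta>\<^sup>2 / 2)" using hE by simp
    have fE: "E \<le> f n"
      unfolding E_def f\<phi>[OF n(1)] using discrete_concave_ge_chord[OF conc', of l n r] lr lr' by simp
    have "chord \<phi> l1 r1 n \<le> chord \<phi> l r n"
      using discrete_concave_chord_refine[OF conc', of l1 l r r1 n] X1_lr lr by simp
    then have gap: "\<phi> n - chord \<phi> l r n \<le> e n" using 1(5) by simp
    have "E = f n * exp (- (\<phi> n - chord \<phi> l r n))"
      unfolding E_def f\<phi>[OF n(1)] by (simp flip: exp_add)
    moreover have "1 - e n \<le> exp (- (\<phi> n - chord \<phi> l r n))"
      using exp_ge_add_one_self[of "- (\<phi> n - chord \<phi> l r n)"] gap by linarith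
    ultimately have "f n * (1 - e n) \<le> E" using pos[OF n(1)] by simp
    moreover have "f n * e n \<le> f a * e n" using fl X1(5) by (intro mult_right_mono)
    ultimately have fE': "f n \<le> E + f a * e n" by (simp add: algebra_simps)
    have "0 \<le> f a * e n" "0 \<le> f a * (\<eta>\<^sup>2 / 2)" using pos[of a] ab X1(5) by simp_all
    then have 3: "\<bar>f n - h n\<bar> \<le> f a * (e n + \<eta>\<^sup>2 / 2)"
      using hE' fE' hE(1) fE unfolding distrib_left by linarith
    have "h n = (1 - w) * f l + w * f r" by (simp add: lr(6) w(3))
    also have "\<dots> \<le> (1 - w) * f a + w * f a" using w fl by (intro add_mono mult_left_mono) auto
    finally have "h n \<le> f a" by (simp add: algebra_simps)
    moreover have "0 \<le> h n" using hE(1) by (simp add: E_def order_trans[OF _ hE(1)])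
    ultimately show ?thesis using 3 by blast
  qed
  have bounds: "0 \<le> h n \<and> h n \<le> f a" if "n \<in> {a..b}" for n
    using main[OF that] h(2)[of n] pos[OF that] mono[of a n] that by (cases "n \<in> X") auto
  \<comment> \<open>Dropping the node \<open>b\<close> leaves \<open>b - a\<close> terms. The length
    \<open>b - a\<close> rather than \<open>b - a + 1\<close> makes the bound vanish on a one-point
    block.\<close>
  have "(\<Sum>n\<in>{a..b}. \<bar>f n - h n\<bar>) = (\<Sum>n\<in>{a..<b}. \<bar>f n - h n\<bar>)"
    using h(2)[OF X(4)] by (intro sum.mono_neutral_right) (auto simp: not_less)
  also have "\<dots> \<le> (\<Sum>n\<in>{a..<b}. f a * (e n + \<eta>\<^sup>2 / 2))"
  proof (rule sum_mono)
    fix n assume "n \<in> {a..<b}"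
    then show "\<bar>f n - h n\<bar> \<le> f a * (e n + \<eta>\<^sup>2 / 2)"
      using main[of n] h(2)[of n] pos[of a] ab X1(5)[of n] by (cases "n \<in> X") auto
  qed
  also have "\<dots> = f a * (sum e {a..<b} + L * (\<eta>\<^sup>2 / 2))"
    using ab by (simp add: sum.distrib L_def flip: sum_distrib_left)
  also have "\<dots> \<le> f a * (3 * L / 4 ^ d + L * (5 / 4 ^ d))"
  proof (intro mult_left_mono add_mono)
    have "sum e {a..<b} \<le> sum e {a..b}" using X1(5) by (intro sum_mono2) auto
    then show "sum e {a..<b} \<le> 3 * L / 4 ^ d" using se by simp
    have "\<eta>\<^sup>2 / 2 = 9 / 2 / 4 ^ d"
      by (simp add: \<eta>_def power_divide power2_eq_square flip: power_mult_distrib)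
    also have "\<dots> \<le> 5 / 4 ^ d" by (intro divide_right_mono) auto
    finally show "\<eta>\<^sup>2 / 2 \<le> 5 / 4 ^ d" .
  qed (use L pos[of a] ab in auto)
  also have "\<dots> = 8 * f a * (real_of_int b - real_of_int a) / 4 ^ d"
    unfolding L_def by (simp add: field_simps)
  finally show ?thesis using labelled_affine_mono[OF h(1) card] bounds by blast
qed

section \<open>Log-concave sequences\<close>

text \<open>\<open>\<phi> i\<close> lies above the chord from \<open>p\<close> to \<open>j\<close>,
  both of whose end values are at least \<open>\<phi> j\<close>.\<close>

lemma discrete_concave_decreasing_after_max:
  assumes c: "discrete_concave u v \<phi>" and "u \<le> p" "p \<le> i" "i \<le> j" "j \<le> v" and max: "\<phi> j \<le> \<phi> p"
  shows "\<phi> j \<le> \<phi> i"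
proof (cases "p < j")
  case True
  obtain w where w: "0 \<le> w" "w \<le> 1" "chord \<phi> p j i = (1 - w) * \<phi> p + w * \<phi> j"
    using chord_convex_combination[of p j i] True assms by metis
  have "\<phi> j = (1 - w) * \<phi> j + w * \<phi> j" by (simp add: algebra_simps)
  also have "\<dots> \<le> (1 - w) * \<phi> p + w * \<phi> j" using w max by (intro add_mono mult_left_mono) auto
  also have "\<dots> \<le> \<phi> i" using discrete_concave_ge_chord[OF c, of p i j] assms w(3) by simp
  finally show ?thesis .
next
  case False
  then have "i = j" using assms by simp
  then show ?thesis by simp
qed

lemma log_concave_shift_mass:
  fixes f :: "int \<Rightarrow> real"
  assumes pos: "\<And>n. n \<in> {a..v} \<Longrightarrow> 0 < f n"
    and conc: "discrete_concave a v (\<lambda>n. ln (f n))"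
    and "a \<le> b" and small: "b < v \<Longrightarrow> f (b + 1) \<le> f a / 8"
  shows "sum f {b + 1..v} \<le> sum f {a..v} / 8"
proof (cases "b < v")
  case True
  define t where "t = b + 1 - a"
  have ratio: "ln (f n) - ln (f (n - t)) \<le> ln (f (b + 1)) - ln (f a)" if "b + 1 \<le> n" "n \<le> v" for n
    using that
  proof (induction n rule: int_ge_induct)
    case base
    then show ?case by (simp add: t_def)
  next
    case (step n)
    have "ln (f (n + 1)) - ln (f n) \<le> ln (f (n - t + 1)) - ln (f (n - t))"
      using conc[unfolded discrete_concave_def, rule_format, of "n - t" n] step \<open>a \<le> b\<close>
      by (simp add: t_def)
    moreover have eq: "n + 1 - t = n - t + 1" by simp
    ultimately show ?case using step unfolding eq by linarith
  qed
  have le: "f n \<le> f (n - t) / 8" if n: "n \<in> {b + 1..v}" for n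
  proof -
    have p: "0 < f n" "0 < f (n - t)" "0 < f (b + 1)" "0 < f a"
      using n \<open>a \<le> b\<close> by (auto intro!: pos simp: t_def)
    have "ln (f n / f (n - t)) \<le> ln (f (b + 1) / f a)" using ratio[of n] n p by (simp add: ln_div)
    then have "f n / f (n - t) \<le> f (b + 1) / f a" using p by simp
    also have "\<dots> \<le> 1 / 8" using small[OF True] p by (simp add: field_simps)
    finally show ?thesis using p by (simp add: field_simps)
  qed
  have "sum f {b + 1..v} \<le> (\<Sum>n\<in>{b + 1..v}. f (n - t) / 8)" using le by (rule sum_mono)
  also have "\<dots> = (\<Sum>n\<in>(\<lambda>n. n - t) ` {b + 1..v}. f n) / 8"
    by (subst sum.reindex) (auto simp: sum_divide_distrib inj_on_def)
  also have "\<dots> \<le> sum f {a..v} / 8"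
    using \<open>a \<le> b\<close> pos by (intro divide_right_mono sum_mono2) (auto simp: t_def less_imp_le)
  finally show ?thesis .
next
  case False
  have "0 \<le> sum f {a..v}" using pos by (intro sum_nonneg) (auto simp: less_imp_le)
  then show ?thesis using False by simp
qed

text \<open>Both constants are fixed points of the recursion. Pieces:
  \<open>7 * 2 ^ Suc N + 14 * 2 ^ N = 14 * 2 ^ Suc N\<close>. Error, in units of the mass divided by
  \<open>4 ^ Suc N\<close>: the first block costs 64, and the tail costs
  \<open>128 * 4 / 8 = 64\<close>. At \<open>N = 0\<close> the zero function is good enough.\<close>

lemma decreasing_approximation:
  fixes f :: "int \<Rightarrow> real"
  assumes "\<And>n. n \<in> {a..v} \<Longrightarrow> 0 < f n"
    and "discrete_concave a v (\<lambda>n. ln (f n))"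
    and "\<And>i j. a \<le> i \<Longrightarrow> i \<le> j \<Longrightarrow> j \<le> v \<Longrightarrow> f j \<le> f i"
  shows "\<exists>h. labelled_affine real_of_int (14 * 2 ^ N) h \<and> (\<forall>n\<in>{a..v}. 0 \<le> h n \<and> h n \<le> f a) \<and>
    (\<Sum>n\<in>{a..v}. \<bar>f n - h n\<bar>) \<le> 128 * sum f {a..v} / 4 ^ N"
  using assms
proof (induction N arbitrary: a)
  case 0
  have "labelled_affine real_of_int (14 * 2 ^ 0) (\<lambda>_. 0)"
    by (rule labelled_affine_mono[OF labelled_affine_const]) simp
  moreover have "(\<Sum>n\<in>{a..v}. \<bar>f n - 0\<bar>) = sum f {a..v}"
    using 0(1) by (intro sum.cong) (auto simp: less_imp_le)
  moreover have "0 \<le> sum f {a..v}" using 0(1) by (intro sum_nonneg) (auto simp: less_imp_le)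
  moreover have "0 \<le> f a" if "a \<le> v" using 0(1)[of a] that by simp
  ultimately show ?case by (intro exI[of _ "\<lambda>_. 0"]) auto
next
  case (Suc N)
  show ?case
  proof (cases "a \<le> v")
    case False
    have "labelled_affine real_of_int (14 * 2 ^ Suc N) (\<lambda>_. 0)"
      by (rule labelled_affine_mono[OF labelled_affine_const]) (simp add: Suc_leI)
    then show ?thesis using False by (intro exI[of _ "\<lambda>_. 0"]) auto
  next
    case True
    define S where "S = {n\<in>{a..v}. f a / 8 \<le> f n}"
    have fin: "finite S" unfolding S_def by (rule finite_Collect_conjI) simp
    have aS: "a \<in> S" using True Suc.prems(1)[of a] by (simp add: S_def)
    define b where "b = Max S"
    have bS: "b \<in> S" unfolding b_def using fin aS by (intro Max_in) auto
    have ab: "a \<le> b" and bv: "b \<le> v" and level: "f a / 8 \<le> f b" using bS by (auto simp: S_def)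
    have small: "f (b + 1) \<le> f a / 8" if "b < v"
    proof (rule ccontr)
      assume "\<not> ?thesis"
      then have "b + 1 \<in> S" using that ab by (simp add: S_def)
      then show False using Max_ge[OF fin] by (force simp: b_def)
    qed
    have "\<exists>h. labelled_affine real_of_int (7 * 2 ^ Suc N) h \<and> (\<forall>n\<in>{a..b}. 0 \<le> h n \<and> h n \<le> f a) \<and>
      (\<Sum>n\<in>{a..b}. \<bar>f n - h n\<bar>) \<le> 8 * f a * (real_of_int b - real_of_int a) / 4 ^ Suc N"
      using Suc.prems bv ab level
      by (intro level_approximation) (auto intro: discrete_concave_subset)
    then obtain h1 where h1: "labelled_affine real_of_int (7 * 2 ^ Suc N) h1"
      "\<And>n. n \<in> {a..b} \<Longrightarrow> 0 \<le> h1 n \<and> h1 n \<le> f a"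
      "(\<Sum>n\<in>{a..b}. \<bar>f n - h1 n\<bar>) \<le> 8 * f a * (real_of_int b - real_of_int a) / 4 ^ Suc N"
      by blast
    have "\<exists>h. labelled_affine real_of_int (14 * 2 ^ N) h \<and> (\<forall>n\<in>{b+1..v}. 0 \<le> h n \<and> h n \<le> f (b+1)) \<and>
      (\<Sum>n\<in>{b+1..v}. \<bar>f n - h n\<bar>) \<le> 128 * sum f {b+1..v} / 4 ^ N"
      using Suc.prems ab by (intro Suc.IH) (auto intro: discrete_concave_subset)
    then obtain h2 where h2: "labelled_affine real_of_int (14 * 2 ^ N) h2"
      "\<And>n. n \<in> {b+1..v} \<Longrightarrow> 0 \<le> h2 n \<and> h2 n \<le> f (b+1)"
      "(\<Sum>n\<in>{b+1..v}. \<bar>f n - h2 n\<bar>) \<le> 128 * sum f {b+1..v} / 4 ^ N" by blast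
    define h where "h = (\<lambda>n. if n < b + 1 then h1 n else h2 n)"
    have "labelled_affine real_of_int (7 * 2 ^ Suc N + 14 * 2 ^ N) h"
      unfolding h_def by (rule labelled_affine_If[OF h1(1) h2(1)])
    then have K: "labelled_affine real_of_int (14 * 2 ^ Suc N) h" by simp
    have bounds: "0 \<le> h n \<and> h n \<le> f a" if "n \<in> {a..v}" for n
      using h1(2)[of n] h2(2)[of n] Suc.prems(3)[of a "b + 1"] ab that by (auto simp: h_def)
    define m where "m = sum f {a..v}"
    \<comment> \<open>All values on the block are at least \<open>f a / 8\<close>, so the rectangle
      of height \<open>f a\<close> over it has at most 8 times its mass.\<close>
    have "f a / 8 * (real_of_int b - real_of_int a) = (\<Sum>n\<in>{a..<b}. f a / 8)" using ab by simp
    also have "\<dots> \<le> sum f {a..<b}"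
      using bv by (intro sum_mono order_trans[OF level Suc.prems(3)]) auto
    also have "\<dots> \<le> m" unfolding m_def
      using Suc.prems(1) bv by (intro sum_mono2) (auto simp: less_imp_le)
    finally have "8 * f a * (real_of_int b - real_of_int a) \<le> 64 * m" by simp
    then have e1: "(\<Sum>n\<in>{a..b}. \<bar>f n - h1 n\<bar>) \<le> 64 * m / 4 ^ Suc N"
      using h1(3) by (meson divide_right_mono order_trans zero_le_numeral zero_le_power)
    have "sum f {b+1..v} \<le> m / 8"
      unfolding m_def using Suc.prems ab small by (intro log_concave_shift_mass) auto
    then have "128 * sum f {b+1..v} / 4 ^ N \<le> 64 * m / 4 ^ Suc N" by (simp add: field_simps)
    then have e2: "(\<Sum>n\<in>{b+1..v}. \<bar>f n - h2 n\<bar>) \<le> 64 * m / 4 ^ Suc N" using h2(3) by simp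
    have "{a..v} = {a..b} \<union> {b+1..v}" using ab bv by auto
    then have "(\<Sum>n\<in>{a..v}. \<bar>f n - h n\<bar>) = (\<Sum>n\<in>{a..b}. \<bar>f n - h n\<bar>) + (\<Sum>n\<in>{b+1..v}. \<bar>f n - h n\<bar>)"
      by (auto intro!: sum.union_disjoint)
    also have "\<dots> = (\<Sum>n\<in>{a..b}. \<bar>f n - h1 n\<bar>) + (\<Sum>n\<in>{b+1..v}. \<bar>f n - h2 n\<bar>)"
      by (intro arg_cong2[of _ _ _ _ "(+)"] sum.cong) (auto simp: h_def)
    also have "\<dots> \<le> 128 * m / 4 ^ Suc N" using e1 e2 by simp
    finally show ?thesis using K bounds unfolding m_def by blast
  qed
qed

lemma sum_reflect_int: "(\<Sum>n\<in>{u..v}. g (- n)) = sum g {- v..- u}" for u v :: int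
  by (rule sum.reindex_bij_witness[of _ uminus uminus]) auto

text \<open>A maximiser \<open>p\<close> cuts the sequence into two monotone halves; the left one is
  reflected to become decreasing.\<close>

lemma log_concave_approximation:
  fixes f :: "int \<Rightarrow> real"
  assumes "u \<le> v" and pos: "\<And>n. n \<in> {u..v} \<Longrightarrow> 0 < f n"
    and lc: "\<And>n. u < n \<Longrightarrow> n < v \<Longrightarrow> f (n - 1) * f (n + 1) \<le> (f n)\<^sup>2"
    and M: "\<And>n. n \<in> {u..v} \<Longrightarrow> f n \<le> M"
  shows "\<exists>h. labelled_affine real_of_int (28 * 2 ^ N) h \<and> (\<forall>n\<in>{u..v}. 0 \<le> h n \<and> h n \<le> M) \<and>
    (\<Sum>n\<in>{u..v}. \<bar>f n - h n\<bar>) \<le> 128 * sum f {u..v} / 4 ^ N"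
proof -
  define \<phi> where "\<phi> = (\<lambda>n. ln (f n))"
  have conc: "discrete_concave u v \<phi>"
  proof (rule discrete_concaveI)
    fix n assume n: "u < n" "n < v"
    then have p: "0 < f (n - 1)" "0 < f (n + 1)" "0 < f n" by (auto intro!: pos)
    then have "ln (f (n - 1) * f (n + 1)) \<le> ln ((f n)\<^sup>2)"
      using lc[OF n] by (intro ln_mono) auto
    then show "\<phi> (n - 1) + \<phi> (n + 1) \<le> 2 * \<phi> n"
      using p by (simp add: \<phi>_def ln_mult ln_realpow)
  qed
  have conc': "discrete_concave (- v) (- u) (\<lambda>n. \<phi> (- n))"
    by (rule discrete_concave_reflect[OF conc])
  have "Max (f ` {u..v}) \<in> f ` {u..v}" using \<open>u \<le> v\<close> by (intro Max_in) auto
  then obtain p where p: "p \<in> {u..v}" "f p = Max (f ` {u..v})" by fastforce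
  have pmax: "f n \<le> f p" if "n \<in> {u..v}" for n using that p(2) by simp
  have \<phi>_le: "\<phi> i \<le> \<phi> j \<longleftrightarrow> f i \<le> f j" if "i \<in> {u..v}" "j \<in> {u..v}" for i j
    using pos[OF that(1)] pos[OF that(2)] by (simp add: \<phi>_def)
  have right: "f j \<le> f i" if "p \<le> i" "i \<le> j" "j \<le> v" for i j
    using discrete_concave_decreasing_after_max[OF conc, of p i j] that p pmax[of j]
    by (auto simp: \<phi>_le)
  have left: "f (- j) \<le> f (- i)" if "- p \<le> i" "i \<le> j" "j \<le> - u" for i j
    using discrete_concave_decreasing_after_max[OF conc', of "- p" i j] that p pmax[of "- j"]
    by (auto simp: \<phi>_le)
  have "\<exists>h. labelled_affine real_of_int (14 * 2 ^ N) h \<and> (\<forall>n\<in>{p..v}. 0 \<le> h n \<and> h n \<le> f p) \<and>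
    (\<Sum>n\<in>{p..v}. \<bar>f n - h n\<bar>) \<le> 128 * sum f {p..v} / 4 ^ N"
    using p by (intro decreasing_approximation)
      (auto intro!: pos right discrete_concave_subset[OF conc[unfolded \<phi>_def]])
  then obtain h2 where h2: "labelled_affine real_of_int (14 * 2 ^ N) h2"
    "\<And>n. n \<in> {p..v} \<Longrightarrow> 0 \<le> h2 n \<and> h2 n \<le> f p"
    "(\<Sum>n\<in>{p..v}. \<bar>f n - h2 n\<bar>) \<le> 128 * sum f {p..v} / 4 ^ N" by blast
  \<comment> \<open>The reflected half starts at \<open>1 - p\<close>, that is at
    \<open>p - 1\<close> before reflection, because \<open>p\<close> itself belongs to the right
    half.\<close>
  have "\<exists>h. labelled_affine real_of_int (14 * 2 ^ N) h \<and>
    (\<forall>n\<in>{1-p..-u}. 0 \<le> h n \<and> h n \<le> f (- (1 - p))) \<and>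
    (\<Sum>n\<in>{1-p..-u}. \<bar>f (- n) - h n\<bar>) \<le> 128 * (\<Sum>n\<in>{1-p..-u}. f (- n)) / 4 ^ N"
    using p by (intro decreasing_approximation)
      (auto intro!: pos left discrete_concave_subset[OF conc'[unfolded \<phi>_def]])
  then obtain h1 where h1: "labelled_affine real_of_int (14 * 2 ^ N) h1"
    "\<And>n. n \<in> {1-p..-u} \<Longrightarrow> 0 \<le> h1 n \<and> h1 n \<le> f (- (1 - p))"
    "(\<Sum>n\<in>{1-p..-u}. \<bar>f (- n) - h1 n\<bar>) \<le> 128 * (\<Sum>n\<in>{1-p..-u}. f (- n)) / 4 ^ N" by blast
  have h1': "(\<Sum>n\<in>{u..p-1}. \<bar>f n - h1 (- n)\<bar>) \<le> 128 * sum f {u..p-1} / 4 ^ N"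
    using h1(3) sum_reflect_int[of f "1 - p" "- u"]
      sum_reflect_int[of "\<lambda>n. \<bar>f n - h1 (- n)\<bar>" "1 - p" "- u"] by simp
  define h where "h = (\<lambda>n. if n < p then h1 (- n) else h2 n)"
  have "labelled_affine real_of_int (14 * 2 ^ N + 14 * 2 ^ N) h"
    unfolding h_def by (rule labelled_affine_If[OF labelled_affine_reflect[OF h1(1)] h2(1)])
  then have K: "labelled_affine real_of_int (28 * 2 ^ N) h" by simp
  have bounds: "0 \<le> h n \<and> h n \<le> M" if "n \<in> {u..v}" for n
    using h1(2)[of "- n"] h2(2)[of n] M[of p] M[of "p - 1"] p(1) that
    by (cases "n < p") (auto simp: h_def)
  have U: "{u..v} = {u..p-1} \<union> {p..v}" using p by auto
  have split: "sum g {u..v} = sum g {u..p-1} + sum g {p..v}" for g :: "int \<Rightarrow> real"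
    unfolding U by (rule sum.union_disjoint) auto
  have "(\<Sum>n\<in>{u..v}. \<bar>f n - h n\<bar>) = (\<Sum>n\<in>{u..p-1}. \<bar>f n - h1 (- n)\<bar>) + (\<Sum>n\<in>{p..v}. \<bar>f n - h2 n\<bar>)"
    unfolding split by (intro arg_cong2[of _ _ _ _ "(+)"] sum.cong) (auto simp: h_def)
  also have "\<dots> \<le> 128 * sum f {u..v} / 4 ^ N"
    using h1' h2(3) unfolding split by (simp add: add_divide_distrib)
  finally show ?thesis using K bounds by blast
qed

section \<open>From labelled functions to densities\<close>

lemma labelled_affine_scale:
  assumes "labelled_affine \<iota> K h"
  shows "labelled_affine \<iota> K (\<lambda>x. h x / s)"
proof -
  obtain c p q where c: "mono c" "\<And>x. c x < K" "\<And>x. h x = p (c x) * \<iota> x + q (c x)"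
    using assms unfolding labelled_affine_def by blast
  show ?thesis
    by (rule labelled_affineI[where c = c and P = "\<lambda>x. p (c x) / s" and Q = "\<lambda>x. q (c x) / s"])
      (use c in \<open>auto simp: add_divide_distrib\<close>)
qed

text \<open>An affine piece changes sign at most once, so each block splits into at most
  two.\<close>

lemma labelled_affine_pos_part:
  assumes "labelled_affine \<iota> K h" "mono \<iota>"
  shows "labelled_affine \<iota> (2 * K) (\<lambda>x. max 0 (h x))"
proof -
  obtain c p q where c: "mono c" "\<And>x. c x < K" "\<And>x. h x = p (c x) * \<iota> x + q (c x)"
    using assms(1) unfolding labelled_affine_def by blast
  \<comment> \<open>The extra bit must increase along the block: for nonnegative slope it marks the
    part where \<open>h\<close> is nonnegative, for negative slope the part where \<open>h\<close>
    is negative.\<close>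
  define s :: "'a \<Rightarrow> nat" where "s = (\<lambda>x. of_bool (0 \<le> p (c x) \<longleftrightarrow> 0 \<le> h x))"
  have s_le: "s x \<le> 1" for x by (simp add: s_def)
  show ?thesis
  proof (rule labelled_affineI[where c = "\<lambda>x. 2 * c x + s x" and P = "\<lambda>x. if 0 \<le> h x then p (c x) else 0"
        and Q = "\<lambda>x. if 0 \<le> h x then q (c x) else 0"])
    show "mono (\<lambda>x. 2 * c x + s x)"
    proof (rule monoI)
      fix x y :: 'a assume xy: "x \<le> y"
      show "2 * c x + s x \<le> 2 * c y + s y"
      proof (cases "c x = c y")
        case True
        have i: "\<iota> x \<le> \<iota> y" using assms(2) xy by (rule monoD)
        have "h x \<le> h y" if "0 \<le> p (c x)"
          using mult_left_mono[OF i that] c(3)[of x] c(3)[of y] True by simp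
        moreover have "h y \<le> h x" if "\<not> 0 \<le> p (c x)"
          using mult_left_mono_neg[OF i, of "p (c x)"] that c(3)[of x] c(3)[of y] True by simp
        ultimately have "s x \<le> s y" using True by (auto simp: s_def)
        then show ?thesis using True by simp
      next
        case False
        then have "c x < c y" using c(1) xy by (simp add: monoD order_le_neq_trans)
        then show ?thesis using s_le[of x] by simp
      qed
    qed
    show "2 * c x + s x < 2 * K" for x using c(2)[of x] s_le[of x] by simp
    fix x y assume "2 * c x + s x = 2 * c y + s y"
    then have "c x = c y" "s x = s y" using s_le[of x] s_le[of y] by presburger+
    moreover have "0 \<le> h x \<longleftrightarrow> 0 \<le> h y"
      using calculation by (auto simp: s_def of_bool_def split: if_splits)
    ultimately show "(if 0 \<le> h x then p (c x) else 0) = (if 0 \<le> h y then p (c y) else 0) \<and>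
      (if 0 \<le> h x then q (c x) else 0) = (if 0 \<le> h y then q (c y) else 0)"
      by simp
  qed (use c(3) in auto)
qed

text \<open>Fibres of a monotone label are order intervals. Only attained labels give blocks, hence
  at most \<open>K\<close> instead of exactly \<open>K\<close>.\<close>

lemma labelled_affine_piecewise_affine:
  assumes "labelled_affine \<iota> K h"
  shows "\<exists>m\<le>K. piecewise_affine \<iota> m h"
proof -
  obtain c p q where c: "mono c" "\<And>x. c x < K" "\<And>x. h x = p (c x) * \<iota> x + q (c x)"
    using assms unfolding labelled_affine_def by blast
  define P where "P = (\<lambda>j. c -` {j}) ` range c"
  have sub: "range c \<subseteq> {..<K}" using c(2) by auto
  then have fin: "finite (range c)" using finite_subset by blast
  have "card P \<le> card (range c)" unfolding P_def by (rule card_image_le[OF fin])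
  also have "\<dots> \<le> K" using card_mono[OF _ sub] by simp
  finally have card: "card P \<le> K" .
  have "partition_on UNIV P"
    by (rule partition_onI) (auto simp: P_def disjnt_def)
  moreover have "order_interval I \<and> (\<exists>a b. \<forall>x\<in>I. h x = a * \<iota> x + b)" if IP: "I \<in> P" for I
  proof -
    obtain j where I: "I = c -` {j}" using IP unfolding P_def by blast
    have "order_interval I"
      unfolding order_interval_def I
    proof (intro ballI subsetI)
      fix a b x assume ab: "a \<in> c -` {j}" "b \<in> c -` {j}" "x \<in> {a..b}"
      then have "c a \<le> c x" "c x \<le> c b" using monoD[OF c(1), of a x] monoD[OF c(1), of x b] by auto
      then show "x \<in> c -` {j}" using ab by simp
    qed
    moreover have "\<forall>x\<in>I. h x = p j * \<iota> x + q j" using c(3) by (auto simp: I)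
    ultimately show ?thesis by blast
  qed
  ultimately have "piecewise_affine \<iota> (card P) h"
    unfolding piecewise_affine_def using fin by (intro exI[of _ P]) (auto simp: P_def)
  then show ?thesis using card by blast
qed

text \<open>The mass \<open>s\<close> of \<open>h\<close> differs from 1 by at most
  \<open>\<eta>\<close>, and rescaling moves \<open>h\<close> by exactly
  \<open>\<bar>s - 1\<bar>\<close> in the integral norm. The total \<open>2 * \<eta>\<close> is
  halved by the definition of total variation; \<open>\<eta> < 1\<close> keeps \<open>s\<close>
  positive.\<close>

lemma tv_dist_normalize:
  assumes f: "is_density M f" and h: "\<And>x. 0 \<le> h x" "integrable M h"
    and err: "(LINT x|M. \<bar>f x - h x\<bar>) \<le> \<eta>" and "\<eta> < 1"
  shows "\<exists>s. is_density M (\<lambda>x. h x / s) \<and> tv_dist M f (\<lambda>x. h x / s) \<le> \<eta>"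
proof (intro exI conjI)
  have fi: "integrable M f" "integral\<^sup>L M f = 1"
    using f unfolding is_density_def by (auto simp: has_bochner_integral_iff)
  define s where "s = integral\<^sup>L M h"
  have "\<bar>1 - s\<bar> = \<bar>LINT x|M. f x - h x\<bar>" using fi h by (simp add: s_def)
  also have "\<dots> \<le> (LINT x|M. \<bar>f x - h x\<bar>)" by (rule integral_abs_bound)
  finally have s1: "\<bar>1 - s\<bar> \<le> \<eta>" using err by simp
  then have s0: "s > 0" using \<open>\<eta> < 1\<close> by linarith
  show "is_density M (\<lambda>x. h x / s)"
    unfolding is_density_def has_bochner_integral_iff using h s0 by (auto simp: s_def)
  have "(LINT x|M. \<bar>f x - h x / s\<bar>) \<le> (LINT x|M. \<bar>f x - h x\<bar> + h x * \<bar>1 - 1 / s\<bar>)"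
  proof (rule integral_mono)
    show "\<bar>f x - h x / s\<bar> \<le> \<bar>f x - h x\<bar> + h x * \<bar>1 - 1 / s\<bar>" for x
    proof -
      have "h x * \<bar>1 - 1 / s\<bar> = \<bar>h x * (1 - 1 / s)\<bar>" using h(1)[of x] by (simp only: abs_mult abs_of_nonneg)
      also have "\<dots> = \<bar>h x - h x / s\<bar>" by (simp add: right_diff_distrib)
      finally have "h x * \<bar>1 - 1 / s\<bar> = \<bar>h x - h x / s\<bar>" .
      then show ?thesis by linarith
    qed
  qed (use fi h in auto)
  also have "\<dots> = (LINT x|M. \<bar>f x - h x\<bar>) + s * \<bar>1 - 1 / s\<bar>"
    using fi h by (simp add: s_def)
  also have "s * \<bar>1 - 1 / s\<bar> = \<bar>s - 1\<bar>" using s0 by (simp add: abs_if field_simps)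
  finally show "tv_dist M f (\<lambda>x. h x / s) \<le> \<eta>" using err s1 by (simp add: tv_dist_def)
qed

text \<open>Since \<open>f\<close> is nonnegative, clipping \<open>h\<close> at 0 only brings it
  closer to \<open>f\<close>.\<close>

lemma labelled_affine_to_density:
  assumes f: "is_density M f" and h: "labelled_affine \<iota> K h" "integrable M h" and "mono \<iota>"
    and err: "(LINT x|M. \<bar>f x - h x\<bar>) \<le> \<eta>" and "\<eta> < 1"
  shows "\<exists>g m. is_density M g \<and> piecewise_affine \<iota> m g \<and> m \<le> 2 * K \<and> tv_dist M f g \<le> \<eta>"
proof -
  define h' where "h' = (\<lambda>x. max 0 (h x))"
  have fi: "integrable M f" "\<And>x. 0 \<le> f x"
    using f unfolding is_density_def by (auto simp: has_bochner_integral_iff)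
  have h': "integrable M h'" unfolding h'_def using h(2) by (intro integrable_max) auto
  have "(LINT x|M. \<bar>f x - h' x\<bar>) \<le> (LINT x|M. \<bar>f x - h x\<bar>)"
  proof (rule integral_mono)
    show "\<bar>f x - h' x\<bar> \<le> \<bar>f x - h x\<bar>" for x using fi(2)[of x] by (auto simp: h'_def)
  qed (use fi h h' in auto)
  then obtain s where s: "is_density M (\<lambda>x. h' x / s)" "tv_dist M f (\<lambda>x. h' x / s) \<le> \<eta>"
    using tv_dist_normalize[OF f, of h' \<eta>] h' err \<open>\<eta> < 1\<close> by (auto simp: h'_def)
  have "labelled_affine \<iota> (2 * K) (\<lambda>x. h' x / s)"
    unfolding h'_def by (intro labelled_affine_scale labelled_affine_pos_part h assms)
  then obtain m where "m \<le> 2 * K" "piecewise_affine \<iota> m (\<lambda>x. h' x / s)"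
    using labelled_affine_piecewise_affine by blast
  then show ?thesis using s by blast
qed

section \<open>Truncation to a bounded window and the case of the integers\<close>

lemma tail_mass_small:
  fixes f \<iota> :: "'a \<Rightarrow> real"
  assumes "integrable M f" "\<iota> \<in> borel_measurable M" "0 < \<tau>"
  shows "\<exists>n::nat. (LINT x|M. f x * indicator {x. real n < \<bar>\<iota> x\<bar>} x) < \<tau>"
proof -
  have ind: "indicator {x. real n < \<bar>\<iota> x\<bar>} x = (if real n < \<bar>\<iota> x\<bar> then 1 else 0 :: real)" for n x
    by (simp add: indicator_def)
  have "(\<lambda>n. LINT x|M. f x * indicator {x. real n < \<bar>\<iota> x\<bar>} x) \<longlonglongrightarrow> (LINT x|M. 0)"
  proof (rule integral_dominated_convergence[where w = "\<lambda>x. \<bar>f x\<bar>"])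
    show "AE x in M. (\<lambda>n. f x * indicator {x. real n < \<bar>\<iota> x\<bar>} x) \<longlonglongrightarrow> 0"
    proof (rule AE_I2)
      fix x
      obtain N :: nat where "\<bar>\<iota> x\<bar> \<le> real N" using real_arch_simple by blast
      then have "eventually (\<lambda>n. f x * indicator {x. real n < \<bar>\<iota> x\<bar>} x = 0) sequentially"
        by (auto simp: eventually_sequentially indicator_def intro!: exI[of _ N])
      then show "(\<lambda>n. f x * indicator {x. real n < \<bar>\<iota> x\<bar>} x) \<longlonglongrightarrow> 0"
        by (rule tendsto_eventually)
    qed
    show "(\<lambda>x. f x * indicator {x. real n < \<bar>\<iota> x\<bar>} x) \<in> borel_measurable M" for n
      unfolding ind using assms by measurable
    show "AE x in M. norm (f x * indicator {x. real n < \<bar>\<iota> x\<bar>} x) \<le> \<bar>f x\<bar>" for n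
      by (auto simp: indicator_def)
  qed (use assms in auto)
  then have "eventually (\<lambda>n. (LINT x|M. f x * indicator {x. real n < \<bar>\<iota> x\<bar>} x) < \<tau>) sequentially"
    using assms(3) by (intro order_tendstoD) auto
  then show ?thesis by (meson eventually_happens sequentially_bot)
qed

text \<open>Logarithms require positivity on a finite range. The range is spanned by the extreme
  points of positive mass inside a window carrying all but \<open>\<eta> / 2\<close>; the absence of
  internal zeroes makes everything between them positive.\<close>

lemma int_approximation:
  fixes f :: "int \<Rightarrow> real"
  assumes f: "is_density (count_space UNIV) f" and lc: "log_concave_int f"
    and \<eta>: "0 < \<eta>" "\<eta> < 1" and N: "1024 \<le> 4 ^ N * \<eta>"
  shows "\<exists>g m. piecewise_linear_distribution_int m g \<and> m \<le> 60 * 2 ^ N \<and> tv_dist (count_space UNIV) f g \<le> \<eta>"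
proof -
  let ?M = "count_space (UNIV :: int set)"
  have fi: "integrable ?M f" "integral\<^sup>L ?M f = 1" and f0: "\<And>x. 0 \<le> f x"
    using f unfolding is_density_def by (auto simp: has_bochner_integral_iff)
  obtain n :: nat where n: "(LINT x|?M. f x * indicator {x. real n < \<bar>real_of_int x\<bar>} x) < \<eta> / 2"
    using tail_mass_small[OF fi(1), of real_of_int "\<eta> / 2"] \<eta> by auto
  define T where "T = (\<lambda>x. f x * indicator {x. real n < \<bar>real_of_int x\<bar>} x)"
  have Ti: "integrable ?M T"
    by (rule Bochner_Integration.integrable_bound[OF fi(1)]) (auto simp: T_def indicator_def)
  define S where "S = {x\<in>{- int n..int n}. f x > 0}"
  have fin: "finite S" unfolding S_def by (rule finite_Collect_conjI) simp
  have fT: "f x = T x" if "x \<notin> S" for x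
    using that f0[of x] by (auto simp: S_def T_def indicator_def)
  have "S \<noteq> {}"
  proof
    assume "S = {}"
    then have "f = T" using fT by auto
    then show False using n fi \<eta> unfolding T_def[symmetric] by simp
  qed
  define u where "u = Min S"
  define v where "v = Max S"
  have uv: "u \<in> S" "v \<in> S" unfolding u_def v_def using fin \<open>S \<noteq> {}\<close> by auto
  have S_uv: "x \<in> {u..v}" if "x \<in> S" for x using that fin by (simp add: u_def v_def)
  have le: "u \<le> v" using S_uv[OF uv(1)] by simp
  have pos: "0 < f x" if "x \<in> {u..v}" for x
  proof (cases "x = u \<or> x = v")
    case True
    then show ?thesis using uv by (auto simp: S_def)
  next
    case False
    then have "u < x \<and> x < v \<and> f u \<noteq> 0 \<and> f v \<noteq> 0" using that uv by (auto simp: S_def)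
    then have "f x \<noteq> 0" using lc unfolding log_concave_int_def by blast
    then show ?thesis using f0[of x] by simp
  qed
  have "\<exists>h. labelled_affine real_of_int (28 * 2 ^ N) h \<and> (\<forall>n\<in>{u..v}. 0 \<le> h n \<and> h n \<le> 1) \<and>
    (\<Sum>n\<in>{u..v}. \<bar>f n - h n\<bar>) \<le> 128 * sum f {u..v} / 4 ^ N"
    using lc le pos unfolding log_concave_int_def by (intro log_concave_approximation) auto
  then obtain h where h: "labelled_affine real_of_int (28 * 2 ^ N) h"
    "(\<Sum>n\<in>{u..v}. \<bar>f n - h n\<bar>) \<le> 128 * sum f {u..v} / 4 ^ N" by blast
  have "has_bochner_integral ?M (\<lambda>x. \<Sum>k\<in>{u..v}. g k * indicator {k} x)
    (\<Sum>k\<in>{u..v}. g k * measure ?M {k})" for g :: "int \<Rightarrow> real"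
    by (intro has_bochner_integral_sum has_bochner_integral_mult_right has_bochner_integral_real_indicator) auto
  then have int_ind: "integrable ?M (\<lambda>x. \<Sum>k\<in>{u..v}. g k * indicator {k} x)"
    "(LINT x|?M. (\<Sum>k\<in>{u..v}. g k * indicator {k} x)) = sum g {u..v}" for g :: "int \<Rightarrow> real"
    unfolding has_bochner_integral_iff by (auto simp only: measure_count_space) simp
  have sum_ind: "(\<Sum>k\<in>{u..v}. g k * indicator {k} x) = (if x \<in> {u..v} then g x else 0)"
    for g :: "int \<Rightarrow> real" and x
  proof -
    have "(\<Sum>k\<in>{u..v}. g k * indicator {k} x) = (\<Sum>k\<in>{u..v}. if k = x then g k else 0)"
      by (intro sum.cong) (auto simp: indicator_def)
    then show ?thesis by (simp add: sum.delta)
  qed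
  have "sum f {u..v} \<le> integral\<^sup>L ?M f"
    unfolding int_ind(2)[of f, symmetric]
    by (rule integral_mono[OF int_ind(1) fi(1)]) (use f0 in \<open>auto simp: sum_ind\<close>)
  then have "128 * sum f {u..v} / 4 ^ N \<le> 128 / 4 ^ N" using fi by (intro divide_right_mono) auto
  also have "\<dots> \<le> \<eta> / 2" using N \<eta> by (simp add: field_simps)
  finally have e: "(\<Sum>n\<in>{u..v}. \<bar>f n - h n\<bar>) \<le> \<eta> / 2" using h(2) by simp
  define h' where "h' = (\<lambda>x. if x < u then 0 else if x < v + 1 then h x else 0)"
  \<comment> \<open>The two zero pieces outside the range raise 28 to 30, and clipping later doubles
    this to 60.\<close>
  have "labelled_affine real_of_int (1 + (28 * 2 ^ N + 1)) h'"
    unfolding h'_def by (intro labelled_affine_If labelled_affine_const h)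
  then have K: "labelled_affine real_of_int (30 * 2 ^ N) h'"
    by (rule labelled_affine_mono) simp
  have h'_sum: "h' x = (\<Sum>k\<in>{u..v}. h k * indicator {k} x)" for x
    unfolding sum_ind by (auto simp: h'_def)
  have h'i: "integrable ?M h'" unfolding h'_sum by (rule int_ind)
  have "(LINT x|?M. \<bar>f x - h' x\<bar>) \<le> (LINT x|?M. T x + (\<Sum>k\<in>{u..v}. \<bar>f k - h k\<bar> * indicator {k} x))"
  proof (rule integral_mono)
    show "\<bar>f x - h' x\<bar> \<le> T x + (\<Sum>k\<in>{u..v}. \<bar>f k - h k\<bar> * indicator {k} x)" for x
    proof (cases "x \<in> {u..v}")
      case True
      moreover have "0 \<le> T x" using f0 by (simp add: T_def)
      ultimately show ?thesis unfolding sum_ind h'_sum by simp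
    next
      case False
      then have "f x = T x" using S_uv fT by blast
      then show ?thesis using False f0[of x] unfolding sum_ind h'_sum by auto
    qed
  qed (use fi h'i Ti int_ind in auto)
  also have "\<dots> = integral\<^sup>L ?M T + (\<Sum>k\<in>{u..v}. \<bar>f k - h k\<bar>)"
    by (subst Bochner_Integration.integral_add[OF Ti int_ind(1)]) (simp only: int_ind(2))
  also have "\<dots> \<le> \<eta>" using e n unfolding T_def by simp
  finally have "\<exists>g m. is_density ?M g \<and> piecewise_affine real_of_int m g \<and> m \<le> 2 * (30 * 2 ^ N) \<and>
    tv_dist ?M f g \<le> \<eta>"
    using \<eta> by (intro labelled_affine_to_density[OF f K h'i]) (auto simp: mono_def)
  then show ?thesis unfolding piecewise_linear_distribution_int_def by auto
qed

section \<open>Densities on the real line\<close>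

lemma log_concave_realD:
  assumes "log_concave_real f" "0 < f x" "0 < f y" "0 < t" "t < 1"
  shows "0 < f ((1 - t) * x + t * y)"
    and "(1 - t) * ln (f x) + t * ln (f y) \<le> ln (f ((1 - t) * x + t * y))"
proof -
  obtain \<phi> where \<phi>: "extended_concave \<phi>" "\<And>x. f x = exp_ereal (\<phi> x)"
    using assms(1) unfolding log_concave_real_def by blast
  have fin: "\<phi> z \<noteq> \<infinity>" for z using \<phi>(1) unfolding extended_concave_def by blast
  have real: "\<phi> z = ereal (ln (f z))" if "0 < f z" for z
    using that \<phi>(2)[of z] fin[of z] by (cases "\<phi> z") (auto simp: exp_ereal_def)
  let ?z = "(1 - t) * x + t * y"
  have "ereal (1 - t) * \<phi> x + ereal t * \<phi> y \<le> \<phi> ?z"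
    using \<phi>(1) assms(4,5) unfolding extended_concave_def by blast
  then have le: "ereal ((1 - t) * ln (f x) + t * ln (f y)) \<le> \<phi> ?z"
    using assms real by simp
  then have "\<phi> ?z \<noteq> - \<infinity>" by auto
  then show pos: "0 < f ?z" using \<phi>(2)[of ?z] by (simp add: exp_ereal_def)
  show "(1 - t) * ln (f x) + t * ln (f y) \<le> ln (f ?z)" using le real[OF pos] by simp
qed

text \<open>Concave functions are continuous only on open intervals; at the ends of its support a
  log-concave density may jump.\<close>

lemma log_concave_real_pos_continuous:
  assumes lc: "log_concave_real f" and "0 < f a" "0 < f b"
  shows "\<And>x. x \<in> {a..b} \<Longrightarrow> 0 < f x" and "continuous_on {a<..<b} f"
proof -
  show pos: "0 < f x" if x: "x \<in> {a..b}" for x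
  proof (cases "x = a \<or> x = b")
    case False
    define t where "t = (x - a) / (b - a)"
    have "a < x" "x < b" using x False by auto
    then have t: "0 < t" "t < 1" by (auto simp: t_def)
    have "t * (b - a) = x - a" using \<open>a < x\<close> \<open>x < b\<close> by (simp add: t_def)
    then have "(1 - t) * a + t * b = x" by (simp add: algebra_simps)
    then show ?thesis using log_concave_realD(1)[OF lc assms(2,3) t] by simp
  qed (use assms in auto)
  have "convex_on {a<..<b} (\<lambda>x. - ln (f x))"
  proof (rule convex_onI)
    fix t x y :: real assume *: "t > 0" "t < 1" "x \<in> {a<..<b}" "y \<in> {a<..<b}"
    then show "- ln (f ((1 - t) *\<^sub>R x + t *\<^sub>R y)) \<le> (1 - t) * - ln (f x) + t * - ln (f y)"
      using log_concave_realD(2)[OF lc pos[of x] pos[of y] *(1,2)] by simp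
  qed simp
  then have "continuous_on {a<..<b} (\<lambda>x. - ln (f x))"
    by (intro convex_on_continuous) auto
  from continuous_on_exp[OF continuous_on_minus[OF this]] show "continuous_on {a<..<b} f"
    by (rule continuous_on_eq) (use pos in force)
qed

text \<open>Positive values strictly outside \<open>[\<alpha>, \<beta>]\<close> are supplied so that
  a log-concave \<open>f\<close> is continuous and positive on this closed interval. The three lost
  parts of size \<open>\<tau>\<close> are the mass beyond \<open>\<plusminus>r\<close> and the two
  ends cut off at quantiles of the truncated density.\<close>

lemma density_core_interval:
  fixes f :: "real \<Rightarrow> real"
  assumes f: "is_density lborel f" and \<tau>: "0 < \<tau>" "\<tau> < 1 / 4"
  shows "\<exists>a \<alpha> \<beta> b. a < \<alpha> \<and> \<alpha> < \<beta> \<and> \<beta> < b \<and> 0 < f a \<and> 0 < f b \<and>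
    (LINT x|lborel. f x * indicator (- {\<alpha>..<\<beta>}) x) \<le> 3 * \<tau>"
proof -
  have fi: "integrable lborel f" "integral\<^sup>L lborel f = 1" and f0: "\<And>x. 0 \<le> f x"
    using f unfolding is_density_def by (auto simp: has_bochner_integral_iff)
  have fint: "integrable lborel (\<lambda>x. f x * indicator S x)" if "S \<in> sets borel" for S
    using integrable_mult_indicator[of S lborel f] fi that by (simp add: mult.commute)
  obtain n :: nat where n: "(LINT x|lborel. f x * indicator {x. real n < \<bar>x\<bar>} x) < \<tau>"
    using tail_mass_small[OF fi(1), of "\<lambda>x. x" \<tau>] \<tau> by auto
  define r where "r = real n"
  have HK: "f integrable_on {s..t}" "(LINT x|lborel. f x * indicator {s..t} x) = integral {s..t} f" for s t
  proof -
    have "set_integrable lborel {s..t} f"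
      unfolding set_integrable_def using fint[of "{s..t}"] by (simp add: mult.commute)
    from set_borel_integral_eq_integral[OF this]
    show "f integrable_on {s..t}" "(LINT x|lborel. f x * indicator {s..t} x) = integral {s..t} f"
      by (auto simp: set_lebesgue_integral_def mult.commute)
  qed
  define F where "F = (\<lambda>t. integral {- r..t} f)"
  have F_mono: "F s \<le> F t" if "s \<le> t" for s t
    unfolding F_def using that f0 HK(1) by (intro integral_subset_le) auto
  have cont: "continuous_on {- r..r} F"
    unfolding F_def by (rule indefinite_integral_continuous_1[OF HK(1)])
  have out_meas: "{x::real. r < \<bar>x\<bar>} \<in> sets borel" by measurable
  have "1 = (LINT x|lborel. f x * indicator {x. r < \<bar>x\<bar>} x + f x * indicator {- r..r} x)"
    unfolding fi(2)[symmetric]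
    by (intro Bochner_Integration.integral_cong) (auto simp: indicator_def)
  also have "\<dots> = (LINT x|lborel. f x * indicator {x. r < \<bar>x\<bar>} x) + F r"
    using fint[OF out_meas] fint[of "{- r..r}"] by (simp add: HK(2) F_def)
  finally have Fr: "1 - \<tau> < F r" using n unfolding r_def by simp
  have F0: "F (- r) = 0" by (simp add: F_def)
  have r0: "- r \<le> r" by (simp add: r_def)
  obtain \<alpha> where \<alpha>: "- r \<le> \<alpha>" "\<alpha> \<le> r" "F \<alpha> = \<tau>"
    using IVT'[of F "- r" \<tau> r] cont F0 Fr \<tau> r0 by auto
  obtain \<beta> where \<beta>: "- r \<le> \<beta>" "\<beta> \<le> r" "F \<beta> = F r - \<tau>"
    using IVT'[of F "- r" "F r - \<tau>" r] cont F0 Fr \<tau> r0 by auto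
  have "\<alpha> < \<beta>" using F_mono[of \<beta> \<alpha>] \<alpha> \<beta> Fr \<tau> by linarith
  have F\<beta>: "integral {\<beta>..r} f = \<tau>"
    using Henstock_Kurzweil_Integration.integral_combine[OF \<beta>(1,2) HK(1)] \<beta>(3) by (simp add: F_def)
  have zero: "integral {s..t} f = 0" if "\<And>x. s < x \<Longrightarrow> x < t \<Longrightarrow> f x = 0" for s t
  proof -
    have "integral {s..t} f = integral {s..t} (\<lambda>x. 0)"
      by (rule integral_spike[of "{s, t}"]) (use that in \<open>force simp: order_le_less\<close>)+
    then show ?thesis by simp
  qed
  \<comment> \<open>The integral up to \<open>\<alpha>\<close> is \<open>\<tau> > 0\<close>, so
    \<open>f\<close> cannot vanish everywhere to the left of \<open>\<alpha>\<close>.\<close>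
  obtain a where a: "a < \<alpha>" "0 < f a"
    using zero[of "- r" \<alpha>] \<alpha>(3) \<tau> f0 unfolding F_def by (metis order_le_less less_irrefl)
  obtain b where b: "\<beta> < b" "0 < f b"
    using zero[of \<beta> r] F\<beta> \<tau> f0 by (metis order_le_less less_irrefl)
  have "(LINT x|lborel. f x * indicator (- {\<alpha>..<\<beta>}) x) \<le>
    (LINT x|lborel. f x * indicator {x. r < \<bar>x\<bar>} x + (f x * indicator {- r..\<alpha>} x + f x * indicator {\<beta>..r} x))"
  proof (rule integral_mono)
    show "f x * indicator (- {\<alpha>..<\<beta>}) x \<le>
      f x * indicator {x. r < \<bar>x\<bar>} x + (f x * indicator {- r..\<alpha>} x + f x * indicator {\<beta>..r} x)" for x
      using f0[of x] by (auto simp: indicator_def)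
  qed (auto intro!: fint Bochner_Integration.integrable_add out_meas)
  also have "\<dots> = (LINT x|lborel. f x * indicator {x. r < \<bar>x\<bar>} x) +
      ((LINT x|lborel. f x * indicator {- r..\<alpha>} x) + (LINT x|lborel. f x * indicator {\<beta>..r} x))"
    using fint[OF out_meas] fint[of "{- r..\<alpha>}"] fint[of "{\<beta>..r}"] by simp
  also have "\<dots> \<le> 3 * \<tau>"
    using n \<alpha>(3) F\<beta> unfolding HK(2) F_def r_def by simp
  finally show ?thesis using a b \<open>\<alpha> < \<beta>\<close> by blast
qed

section \<open>From grid functions to the real line\<close>

lemma labelled_affine_borel:
  assumes "labelled_affine (\<lambda>x::real. x) K h"
  shows "h \<in> borel_measurable borel"
proof -
  obtain c :: "real \<Rightarrow> nat" and p q where c: "mono c" "\<forall>x. h x = p (c x) * x + q (c x)"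
    using assms unfolding labelled_affine_def by blast
  have "mono (\<lambda>x. real (c x))" using c(1) by (simp add: mono_def)
  then have "(\<lambda>x. real (c x)) \<in> borel_measurable borel" by (rule borel_measurable_mono)
  then have "(\<lambda>x. nat \<lfloor>real (c x)\<rfloor>) \<in> measurable borel (count_space UNIV)" by measurable
  then have "c \<in> measurable borel (count_space UNIV)" by simp
  then have "(\<lambda>x. p (c x) * x + q (c x)) \<in> borel_measurable borel"
    by (rule measurable_compose_countable[where f = "\<lambda>i x. p i * x + q i", rotated]) measurable
  moreover have "h = (\<lambda>x. p (c x) * x + q (c x))" using c(2) by blast
  ultimately show ?thesis by simp
qed

text \<open>A label attained only once in the range admits slope zero; otherwise the slope is bounded by
  the oscillation of the function over the block.\<close>

lemma labelled_affine_small_slopes: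
  assumes "labelled_affine real_of_int K h" and M: "\<And>i. i \<in> {u..v} \<Longrightarrow> 0 \<le> h i \<and> h i \<le> M"
    and "0 \<le> M"
  obtains c p q where "mono c" "\<And>x. c x < K" "\<And>i. i \<in> {u..v} \<Longrightarrow> h i = p (c i) * real_of_int i + q (c i)"
    "(\<Sum>i\<in>{u..v}. \<bar>p (c i)\<bar>) \<le> 2 * M * real K"
proof -
  obtain c p0 q0 where c: "mono c" "\<And>x. c x < K" "\<And>x. h x = p0 (c x) * real_of_int x + q0 (c x)"
    using assms(1) unfolding labelled_affine_def by blast
  define B where "B = (\<lambda>j. {i\<in>{u..v}. c i = j})"
  have fin: "finite (B j)" for j unfolding B_def by (rule finite_Collect_conjI) simp
  define p where "p = (\<lambda>j. if card (B j) \<le> 1 then 0 else p0 j)"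
  define q where "q = (\<lambda>j. if card (B j) \<le> 1 then h (Min (B j)) else q0 j)"
  have "h i = p (c i) * real_of_int i + q (c i)" if i: "i \<in> {u..v}" for i
  proof (cases "card (B (c i)) \<le> 1")
    case True
    have iB: "i \<in> B (c i)" using i by (simp add: B_def)
    have "B (c i) = {i}" using True iB fin[of "c i"] card_le_Suc0_iff_eq[of "B (c i)"] by auto
    then show ?thesis by (simp add: p_def q_def)
  next
    case False
    then show ?thesis by (simp add: p_def q_def c(3))
  qed
  moreover have "(\<Sum>i\<in>{u..v}. \<bar>p (c i)\<bar>) \<le> 2 * M * real K"
  proof -
    have block: "real (card (B j)) * \<bar>p j\<bar> \<le> 2 * M" for j
    proof (cases "card (B j) \<le> 1")
      case True
      then show ?thesis using \<open>0 \<le> M\<close> by (simp add: p_def)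
    next
      case False
      then have ne: "B j \<noteq> {}" by auto
      define l where "l = Min (B j)"
      define r where "r = Max (B j)"
      have lr: "l \<in> B j" "r \<in> B j" using ne fin by (simp_all add: l_def r_def)
      have sub: "B j \<subseteq> {l..r}" using fin by (auto simp: l_def r_def)
      have "card (B j) \<le> nat (r - l + 1)" using card_mono[OF _ sub] by simp
      then have lr_card: "int (card (B j)) \<le> r - l + 1" using False by linarith
      then have "l < r" using False by linarith
      \<comment> \<open>With at least two points, \<open>r - l + 1 \<le> 2 * (r - l)\<close>.
        Cardinality times absolute slope is thus at most twice the oscillation
        \<open>\<bar>h r - h l\<bar> \<le> M\<close>, and summation over the \<open>K\<close> labels
        gives the claim.\<close>
      have cb: "real (card (B j)) \<le> 2 * (real_of_int r - real_of_int l)"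
        using lr_card \<open>l < r\<close> by simp
      have "h r - h l = p0 j * (real_of_int r - real_of_int l)"
        using lr c(3)[of l] c(3)[of r] by (simp add: B_def algebra_simps)
      moreover have "\<bar>h r - h l\<bar> \<le> M" using M[of l] M[of r] lr by (auto simp: B_def)
      ultimately have p0: "(real_of_int r - real_of_int l) * \<bar>p0 j\<bar> \<le> M"
        using \<open>l < r\<close> by (simp add: abs_mult mult.commute)
      have "real (card (B j)) * \<bar>p0 j\<bar> \<le> 2 * (real_of_int r - real_of_int l) * \<bar>p0 j\<bar>"
        using cb by (intro mult_right_mono) auto
      also have "\<dots> \<le> 2 * M" using p0 by (simp only: mult.assoc)
      finally show ?thesis using False by (simp add: p_def)
    qed
    have "(\<Sum>i\<in>{u..v}. \<bar>p (c i)\<bar>) = (\<Sum>j\<in>{..<K}. \<Sum>i\<in>B j. \<bar>p (c i)\<bar>)"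
      unfolding B_def using c(2) by (intro sum.group[symmetric]) auto
    also have "\<dots> = (\<Sum>j\<in>{..<K}. real (card (B j)) * \<bar>p j\<bar>)"
    proof (rule sum.cong[OF refl])
      fix j
      have "(\<Sum>i\<in>B j. \<bar>p (c i)\<bar>) = (\<Sum>i\<in>B j. \<bar>p j\<bar>)" by (intro sum.cong) (auto simp: B_def)
      then show "(\<Sum>i\<in>B j. \<bar>p (c i)\<bar>) = real (card (B j)) * \<bar>p j\<bar>" by simp
    qed
    also have "\<dots> \<le> (\<Sum>j\<in>{..<K}. 2 * M)" using block by (intro sum_mono)
    finally show ?thesis by (simp add: mult.commute)
  qed
  ultimately show ?thesis using that[of c p q] c(1,2) by blast
qed

text \<open>Cellwise constant functions are written as sums of indicators, so that their integrals
  become \<open>\<delta>\<close> times a finite sum. Half-open cells make the index of the cell of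
  \<open>x\<close> a floor.\<close>

lemma grid_cells:
  fixes \<alpha> \<delta> :: real
  assumes "0 < \<delta>"
  shows "has_bochner_integral lborel
      (\<lambda>x. \<Sum>k\<in>{0..<n}. E k * indicator {\<alpha> + \<delta> * real_of_int k..<\<alpha> + \<delta> * (real_of_int k + 1)} x)
      (\<delta> * sum E {0..<n})"
    and "\<lbrakk>\<alpha> \<le> x; x < \<alpha> + \<delta> * real_of_int n\<rbrakk> \<Longrightarrow>
      (\<Sum>k\<in>{0..<n}. E k * indicator {\<alpha> + \<delta> * real_of_int k..<\<alpha> + \<delta> * (real_of_int k + 1)} x) = E \<lfloor>(x - \<alpha>) / \<delta>\<rfloor>"
    and "\<lbrakk>\<alpha> \<le> x; x < \<alpha> + \<delta> * real_of_int n\<rbrakk> \<Longrightarrow> \<lfloor>(x - \<alpha>) / \<delta>\<rfloor> \<in> {0..<n}"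
    and "\<bar>x - (\<alpha> + \<delta> * real_of_int \<lfloor>(x - \<alpha>) / \<delta>\<rfloor>)\<bar> < \<delta>"
    and "\<not> (\<alpha> \<le> x \<and> x < \<alpha> + \<delta> * real_of_int n) \<Longrightarrow>
      (\<Sum>k\<in>{0..<n}. E k * indicator {\<alpha> + \<delta> * real_of_int k..<\<alpha> + \<delta> * (real_of_int k + 1)} x) = 0"
proof -
  let ?I = "\<lambda>k. {\<alpha> + \<delta> * real_of_int k..<\<alpha> + \<delta> * (real_of_int k + 1)}"
  have le: "\<alpha> + \<delta> * real_of_int k \<le> \<alpha> + \<delta> * (real_of_int k + 1)" for k using assms by simp
  have "has_bochner_integral lborel (\<lambda>x. \<Sum>k\<in>{0..<n}. E k * indicator (?I k) x)
    (\<Sum>k\<in>{0..<n}. E k * measure lborel (?I k))"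
    by (intro has_bochner_integral_sum has_bochner_integral_mult_right has_bochner_integral_real_indicator)
      (simp_all only: emeasure_lborel_Ico[OF le], auto)
  moreover have "measure lborel (?I k) = \<delta>" for k using assms by (simp add: algebra_simps)
  ultimately show "has_bochner_integral lborel (\<lambda>x. \<Sum>k\<in>{0..<n}. E k * indicator (?I k) x) (\<delta> * sum E {0..<n})"
    by (simp add: sum_distrib_left mult.commute)
  have cell: "x \<in> ?I k \<longleftrightarrow> k = \<lfloor>(x - \<alpha>) / \<delta>\<rfloor>" for k
  proof -
    have "x \<in> ?I k \<longleftrightarrow> real_of_int k \<le> (x - \<alpha>) / \<delta> \<and> (x - \<alpha>) / \<delta> < real_of_int k + 1"
      using assms by (auto simp: field_simps)
    then show ?thesis by linarith
  qed
  have fl: "\<lfloor>(x - \<alpha>) / \<delta>\<rfloor> \<in> {0..<n} \<longleftrightarrow> \<alpha> \<le> x \<and> x < \<alpha> + \<delta> * real_of_int n"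
    using assms by (auto simp: floor_less_iff field_simps)
  have sum: "(\<Sum>k\<in>{0..<n}. E k * indicator (?I k) x) =
    (if \<lfloor>(x - \<alpha>) / \<delta>\<rfloor> \<in> {0..<n} then E \<lfloor>(x - \<alpha>) / \<delta>\<rfloor> else 0)"
  proof -
    have "(\<Sum>k\<in>{0..<n}. E k * indicator (?I k) x) =
      (\<Sum>k\<in>{0..<n}. if k = \<lfloor>(x - \<alpha>) / \<delta>\<rfloor> then E k else 0)"
      using cell by (intro sum.cong) (auto simp: indicator_def simp del: atLeastLessThan_iff)
    then show ?thesis by (simp add: sum.delta del: atLeastLessThan_iff)
  qed
  show "\<lbrakk>\<alpha> \<le> x; x < \<alpha> + \<delta> * real_of_int n\<rbrakk> \<Longrightarrow> \<lfloor>(x - \<alpha>) / \<delta>\<rfloor> \<in> {0..<n}" using fl by blast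
  show "\<lbrakk>\<alpha> \<le> x; x < \<alpha> + \<delta> * real_of_int n\<rbrakk> \<Longrightarrow>
    (\<Sum>k\<in>{0..<n}. E k * indicator (?I k) x) = E \<lfloor>(x - \<alpha>) / \<delta>\<rfloor>" using fl sum by auto
  show "\<not> (\<alpha> \<le> x \<and> x < \<alpha> + \<delta> * real_of_int n) \<Longrightarrow> (\<Sum>k\<in>{0..<n}. E k * indicator (?I k) x) = 0"
    using fl sum by auto
  have "x \<in> ?I \<lfloor>(x - \<alpha>) / \<delta>\<rfloor>" using cell by blast
  then show "\<bar>x - (\<alpha> + \<delta> * real_of_int \<lfloor>(x - \<alpha>) / \<delta>\<rfloor>)\<bar> < \<delta>" by (simp add: algebra_simps)
qed

text \<open>The error budget is \<open>\<eta> / 4\<close> outside the core,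
  \<open>\<eta> / 8\<close> for replacing \<open>f\<close> by its samples, \<open>\<eta> / 4\<close>
  for approximating the samples, and \<open>\<eta> / 8\<close> for extending affinely inside the
  cells.\<close>

lemma real_approximation:
  fixes f :: "real \<Rightarrow> real"
  assumes f: "is_density lborel f" and lc: "log_concave_real f"
    and \<eta>: "0 < \<eta>" "\<eta> < 1" and N: "1024 \<le> 4 ^ N * \<eta>"
  shows "\<exists>g m. piecewise_linear_distribution_real m g \<and> m \<le> 60 * 2 ^ N \<and> tv_dist lborel f g \<le> \<eta>"
proof -
  have fi: "integrable lborel f" "integral\<^sup>L lborel f = 1" and f0: "\<And>x. 0 \<le> f x"
    using f unfolding is_density_def by (auto simp: has_bochner_integral_iff)
  obtain a \<alpha> \<beta> b where ab: "a < \<alpha>" "\<alpha> < \<beta>" "\<beta> < b" "0 < f a" "0 < f b"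
    and out: "(LINT x|lborel. f x * indicator (- {\<alpha>..<\<beta>}) x) \<le> 3 * (\<eta> / 12)"
  proof -
    have "0 < \<eta> / 12" "\<eta> / 12 < 1 / 4" using \<eta> by simp_all
    then show ?thesis using that density_core_interval[OF f] by blast
  qed
  have pos: "0 < f x" if "x \<in> {\<alpha>..\<beta>}" for x
    using log_concave_real_pos_continuous(1)[OF lc ab(4,5), of x] that ab by auto
  have cont: "continuous_on {\<alpha>..\<beta>} f"
    using log_concave_real_pos_continuous(2)[OF lc ab(4,5)] ab by (auto elim: continuous_on_subset)
  then have "uniformly_continuous_on {\<alpha>..\<beta>} f" by (intro compact_uniformly_continuous) auto
  moreover define \<eta>' where "\<eta>' = \<eta> / 8 / (\<beta> - \<alpha>)"
  have "t * (\<eta> / 8 / t) = \<eta> / 8" if "t \<noteq> 0" for t :: real using that by simp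
  from this[of "\<beta> - \<alpha>"] have \<eta>': "\<eta>' > 0" "(\<beta> - \<alpha>) * \<eta>' = \<eta> / 8"
    using \<eta> ab by (simp_all only: \<eta>'_def) auto
  ultimately obtain d0 where d0: "d0 > 0"
    "\<And>x y. \<lbrakk>x \<in> {\<alpha>..\<beta>}; y \<in> {\<alpha>..\<beta>}; \<bar>x - y\<bar> < d0\<rbrakk> \<Longrightarrow> \<bar>f x - f y\<bar> < \<eta>'"
    unfolding uniformly_continuous_on_def dist_real_def by metis
  have "bounded (f ` {\<alpha>..\<beta>})" using cont by (intro compact_imp_bounded compact_continuous_image) auto
  then obtain M where M0: "M > 0" "\<forall>y\<in>f ` {\<alpha>..\<beta>}. norm y \<le> M"
    unfolding bounded_pos by blast
  have fM: "f x \<le> M" if "x \<in> {\<alpha>..\<beta>}" for x using M0(2) that by force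
  note M = M0(1) fM
  define K :: nat where "K = 28 * 2 ^ N"
  \<comment> \<open>The first summand makes the mesh smaller than the continuity modulus
    \<open>d0\<close>; the second makes the mesh times the slope bound \<open>2 * M * K\<close> at
    most \<open>\<eta> / 8\<close>. \<open>K\<close> does not depend on the mesh, so there is no
    circularity.\<close>
  define R where "R = (\<beta> - \<alpha>) / d0 + 16 * M * real K * (\<beta> - \<alpha>) / \<eta>"
  obtain n0 :: nat where n0: "R < real n0" using reals_Archimedean2 by blast
  define n where "n = int n0"
  have R: "0 \<le> 16 * M * real K * (\<beta> - \<alpha>) / \<eta>" "0 < (\<beta> - \<alpha>) / d0" using M ab \<eta> d0 by simp_all
  have n: "n \<ge> 1" "(\<beta> - \<alpha>) / d0 < real_of_int n" "16 * M * real K * (\<beta> - \<alpha>) / \<eta> \<le> real_of_int n"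
    using n0 R unfolding n_def R_def by simp_all
  define \<delta> where "\<delta> = (\<beta> - \<alpha>) / real_of_int n"
  have \<delta>: "0 < \<delta>" "\<delta> < d0" "\<alpha> + \<delta> * real_of_int n = \<beta>" "\<delta> * (2 * M * real K) \<le> \<eta> / 8"
  proof -
    have n_pos: "real_of_int n > 0" using n(1) by simp
    show "0 < \<delta>" "\<alpha> + \<delta> * real_of_int n = \<beta>" using n_pos ab by (simp_all add: \<delta>_def)
    show "\<delta> < d0" using n(2) n_pos d0(1) by (simp add: \<delta>_def divide_less_eq mult.commute)
    have "16 * M * real K * (\<beta> - \<alpha>) \<le> real_of_int n * \<eta>" using n(3) \<eta>(1) by (simp add: divide_le_eq)
    then show "\<delta> * (2 * M * real K) \<le> \<eta> / 8" using n_pos by (simp add: \<delta>_def divide_simps mult_ac)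
  qed
  define s where "s = (\<lambda>k. \<alpha> + \<delta> * real_of_int k)"
  define A where "A = (\<lambda>k. f (s k))"
  have s: "s k \<in> {\<alpha>..\<beta>}" if "k \<in> {0..n - 1}" for k
    using that \<delta>(1) unfolding \<delta>(3)[symmetric] by (simp add: s_def)
  have "\<exists>h. labelled_affine real_of_int (28 * 2 ^ N) h \<and> (\<forall>k\<in>{0..n - 1}. 0 \<le> h k \<and> h k \<le> M) \<and>
    (\<Sum>k\<in>{0..n - 1}. \<bar>A k - h k\<bar>) \<le> 128 * sum A {0..n - 1} / 4 ^ N"
  proof (rule log_concave_approximation)
    fix k assume k: "0 < k" "k < n - 1"
    have p: "0 < f (s (k - 1))" "0 < f (s (k + 1))" using k by (auto intro!: pos s)
    have m: "(1 - 1 / 2) * s (k - 1) + 1 / 2 * s (k + 1) = s k" by (simp add: s_def algebra_simps)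
    have "0 < f (s k)" "(ln (f (s (k - 1))) + ln (f (s (k + 1)))) / 2 \<le> ln (f (s k))"
      using log_concave_realD[OF lc p, of "1 / 2"] unfolding m by simp_all
    then have "ln (f (s (k - 1)) * f (s (k + 1))) \<le> ln ((f (s k))\<^sup>2)"
      using p by (simp add: ln_mult ln_realpow)
    then show "A (k - 1) * A (k + 1) \<le> (A k)\<^sup>2"
      using p \<open>0 < f (s k)\<close> unfolding A_def by (subst (asm) ln_le_cancel_iff) auto
  qed (use n s pos M in \<open>auto simp: A_def\<close>)
  then obtain h where h: "labelled_affine real_of_int K h" "\<And>k. k \<in> {0..n - 1} \<Longrightarrow> 0 \<le> h k \<and> h k \<le> M"
    "(\<Sum>k\<in>{0..n - 1}. \<bar>A k - h k\<bar>) \<le> 128 * sum A {0..n - 1} / 4 ^ N"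
    unfolding K_def by blast
  obtain c p q where c: "mono c" "\<And>k. c k < K" "\<And>k. k \<in> {0..n - 1} \<Longrightarrow> h k = p (c k) * real_of_int k + q (c k)"
    "(\<Sum>k\<in>{0..n - 1}. \<bar>p (c k)\<bar>) \<le> 2 * M * real K"
    using labelled_affine_small_slopes[OF h(1,2)] M(1) by (metis less_imp_le)
  have dom: "{0..n - 1} = {0..<n}" by auto
  define E where "E = (\<lambda>k. \<eta>' + \<bar>A k - h k\<bar> + \<bar>p (c k)\<bar>)"
  define \<kappa> where "\<kappa> = (\<lambda>x. \<lfloor>(x - \<alpha>) / \<delta>\<rfloor>)"
  define cells where "cells = (\<lambda>E x. \<Sum>k\<in>{0..<n}. E k *
    indicator {\<alpha> + \<delta> * real_of_int k..<\<alpha> + \<delta> * (real_of_int k + 1)} x :: real)"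
  have cells_int: "integrable lborel (cells E)" "integral\<^sup>L lborel (cells E) = \<delta> * sum E {0..<n}" for E
    using grid_cells(1)[OF \<delta>(1), where n = n and E = E and \<alpha> = \<alpha>] unfolding cells_def has_bochner_integral_iff by auto
  have cells_in: "cells E x = E (\<kappa> x)" "\<kappa> x \<in> {0..n - 1}" if "\<alpha> \<le> x" "x < \<beta>" for E x
    using grid_cells(2)[OF \<delta>(1), where n = n and E = E and \<alpha> = \<alpha> and x = x]
      grid_cells(3)[OF \<delta>(1), where n = n and \<alpha> = \<alpha> and x = x] that unfolding \<delta>(3) cells_def \<kappa>_def dom by auto
  have cells_out: "cells E x = 0" if "\<not> (\<alpha> \<le> x \<and> x < \<beta>)" for E x
    using grid_cells(5)[OF \<delta>(1), where n = n and E = E and \<alpha> = \<alpha> and x = x] that unfolding \<delta>(3) cells_def by auto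
  have near: "\<bar>f x - A (\<kappa> x)\<bar> \<le> \<eta>'" if x: "\<alpha> \<le> x" "x < \<beta>" for x
    using d0(2)[of x "s (\<kappa> x)"] s[OF cells_in(2)[OF x]] grid_cells(4)[OF \<delta>(1), where \<alpha> = \<alpha> and x = x] \<delta>(2) x
    unfolding A_def s_def \<kappa>_def by (auto intro!: less_imp_le)
  \<comment> \<open>The label is taken at the cell index, but the affine function at the unrounded
    coordinate: consecutive cells with one label then form a single affine piece.\<close>
  define g0 where "g0 = (\<lambda>x. p (c (\<kappa> x)) * ((x - \<alpha>) / \<delta>) + q (c (\<kappa> x)))"
  define g where "g = (\<lambda>x. if x < \<alpha> then 0 else if x < \<beta> then g0 x else 0)"
  have \<kappa>_mono: "mono \<kappa>" unfolding \<kappa>_def using \<delta>(1) by (auto simp: mono_def intro!: floor_mono divide_right_mono)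
  have "labelled_affine (\<lambda>x. x) K g0"
  proof (rule labelled_affineI[where c = "\<lambda>x. c (\<kappa> x)" and P = "\<lambda>x. p (c (\<kappa> x)) / \<delta>"
        and Q = "\<lambda>x. q (c (\<kappa> x)) - p (c (\<kappa> x)) / \<delta> * \<alpha>"])
    show "mono (\<lambda>x. c (\<kappa> x))" using c(1) \<kappa>_mono by (simp add: mono_def)
    show "g0 x = p (c (\<kappa> x)) / \<delta> * x + (q (c (\<kappa> x)) - p (c (\<kappa> x)) / \<delta> * \<alpha>)" for x
      by (simp add: g0_def diff_divide_distrib algebra_simps)
  qed (use c(2) in auto)
  then have "labelled_affine (\<lambda>x. x) (1 + (K + 1)) g"
    unfolding g_def by (intro labelled_affine_If labelled_affine_const)
  then have L: "labelled_affine (\<lambda>x. x) (30 * 2 ^ N) g"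
    by (rule labelled_affine_mono) (simp add: K_def)
  have g_meas: "g \<in> borel_measurable lborel" using labelled_affine_borel[OF L] by simp
  have oi: "integrable lborel (\<lambda>x. f x * indicator (- {\<alpha>..<\<beta>}) x)"
    using integrable_mult_indicator[of "- {\<alpha>..<\<beta>}" lborel f] fi by (simp add: mult.commute)
  have bound: "\<bar>f x - g x\<bar> \<le> f x * indicator (- {\<alpha>..<\<beta>}) x + cells E x" for x
  proof (cases "\<alpha> \<le> x \<and> x < \<beta>")
    case True
    then have x: "\<alpha> \<le> x" "x < \<beta>" by auto
    define t where "t = (x - \<alpha>) / \<delta>"
    have t: "\<bar>t - real_of_int (\<kappa> x)\<bar> \<le> 1" unfolding \<kappa>_def t_def[symmetric] by linarith
    have "g x = p (c (\<kappa> x)) * t + q (c (\<kappa> x))" using x by (simp add: g_def g0_def t_def)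
    then have "g x - h (\<kappa> x) = p (c (\<kappa> x)) * (t - real_of_int (\<kappa> x))"
      using c(3)[OF cells_in(2)[OF x]] by (simp add: algebra_simps)
    then have "\<bar>g x - h (\<kappa> x)\<bar> = \<bar>p (c (\<kappa> x))\<bar> * \<bar>t - real_of_int (\<kappa> x)\<bar>" by (simp add: abs_mult)
    also have "\<dots> \<le> \<bar>p (c (\<kappa> x))\<bar> * 1" using t by (intro mult_left_mono) auto
    finally have "\<bar>f x - g x\<bar> \<le> E (\<kappa> x)" using near[OF x] unfolding E_def by linarith
    then show ?thesis using x cells_in(1)[OF x] f0[of x] by (simp add: indicator_def)
  next
    case False
    then show ?thesis using cells_out[OF False] f0[of x] by (auto simp: g_def indicator_def)
  qed
  have dom_int: "integrable lborel (\<lambda>x. f x * indicator (- {\<alpha>..<\<beta>}) x + cells E x)"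
    by (intro Bochner_Integration.integrable_add oi cells_int)
  have fg_int: "integrable lborel (\<lambda>x. f x - g x)"
    using bound g_meas fi(1) by (intro Bochner_Integration.integrable_bound[OF dom_int])
      (auto intro!: AE_I2 order_trans[OF bound])
  have g_int: "integrable lborel g"
    using Bochner_Integration.integrable_diff[OF fi(1) fg_int] by simp
  \<comment> \<open>The samples form a Riemann sum of total at most
    \<open>1 + \<eta> / 8 \<le> 2\<close>. With the factor 128 and the share
    \<open>\<eta> / 4\<close> of the budget this explains the hypothesis on \<open>N\<close>:
    \<open>1024 = 128 * 2 * 4\<close>.\<close>
  have "integral\<^sup>L lborel (cells A) \<le> (LINT x|lborel. f x + cells (\<lambda>_. \<eta>') x)"
  proof (rule integral_mono)
    show "cells A x \<le> f x + cells (\<lambda>_. \<eta>') x" for x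
    proof (cases "\<alpha> \<le> x \<and> x < \<beta>")
      case True
      then show ?thesis using near[of x] cells_in(1)[of x] by auto
    next
      case False
      then show ?thesis using f0[of x] by (simp add: cells_out)
    qed
  qed (use cells_int fi in auto)
  also have "\<dots> = 1 + \<delta> * real_of_int n * \<eta>'"
    using cells_int fi n by (simp add: Bochner_Integration.integral_add)
  also have \<delta>n: "\<delta> * real_of_int n = \<beta> - \<alpha>" using \<delta>(3) by simp
  finally have "\<delta> * sum A {0..<n} \<le> 2" using \<eta>'(2) \<eta> by (simp add: cells_int)
  then have "128 / 4 ^ N * (\<delta> * sum A {0..<n}) \<le> 128 / 4 ^ N * 2" by (intro mult_left_mono) auto
  also have "\<dots> \<le> \<eta> / 4" using N by (simp add: field_simps)
  finally have eA: "128 / 4 ^ N * (\<delta> * sum A {0..<n}) \<le> \<eta> / 4" .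
  have "\<delta> * (\<Sum>k\<in>{0..<n}. \<bar>A k - h k\<bar>) \<le> \<delta> * (128 * sum A {0..<n} / 4 ^ N)"
    using h(3) \<delta>(1) unfolding dom by (intro mult_left_mono) auto
  also have "\<dots> = 128 / 4 ^ N * (\<delta> * sum A {0..<n})" by simp
  finally have e1: "\<delta> * (\<Sum>k\<in>{0..<n}. \<bar>A k - h k\<bar>) \<le> \<eta> / 4" using eA by simp
  have "\<delta> * (\<Sum>k\<in>{0..<n}. \<bar>p (c k)\<bar>) \<le> \<delta> * (2 * M * real K)"
    using c(4) \<delta>(1) unfolding dom by (intro mult_left_mono) auto
  then have e2: "\<delta> * (\<Sum>k\<in>{0..<n}. \<bar>p (c k)\<bar>) \<le> \<eta> / 8" using \<delta>(4) by simp
  have "\<delta> * sum E {0..<n} = \<delta> * real_of_int n * \<eta>' + \<delta> * (\<Sum>k\<in>{0..<n}. \<bar>A k - h k\<bar>) + \<delta> * (\<Sum>k\<in>{0..<n}. \<bar>p (c k)\<bar>)"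
    using n by (simp add: E_def sum.distrib algebra_simps)
  also have "\<delta> * real_of_int n * \<eta>' = \<eta> / 8" unfolding \<delta>n by (rule \<eta>'(2))
  finally have eE: "\<delta> * sum E {0..<n} \<le> \<eta> / 2" using e1 e2 by simp
  have "(LINT x|lborel. \<bar>f x - g x\<bar>) \<le> (LINT x|lborel. f x * indicator (- {\<alpha>..<\<beta>}) x + cells E x)"
    using bound fg_int dom_int by (intro integral_mono) auto
  also have "\<dots> = (LINT x|lborel. f x * indicator (- {\<alpha>..<\<beta>}) x) + \<delta> * sum E {0..<n}"
    by (simp only: Bochner_Integration.integral_add[OF oi cells_int(1)] cells_int(2))
  also have "\<dots> \<le> \<eta>" using out eE \<eta> by simp
  finally have "\<exists>g m. is_density lborel g \<and> piecewise_affine (\<lambda>x. x) m g \<and> m \<le> 2 * (30 * 2 ^ N) \<and>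
    tv_dist lborel f g \<le> \<eta>"
    using \<eta> by (intro labelled_affine_to_density[OF f L g_int]) (auto simp: mono_def)
  then show ?thesis unfolding piecewise_linear_distribution_real_def by auto
qed

text \<open>With \<open>r = max 1 (\<epsilon> powr (- 1 / 2))\<close>, rounding up
  \<open>log 2 (64 * r)\<close> puts \<open>2 ^ N\<close> between \<open>64 * r\<close> and
  \<open>128 * r\<close>; hence \<open>7680 = 60 * 128\<close>. Conversely
  \<open>4 ^ N \<ge> 4096 * r\<^sup>2\<close>, and
  \<open>r\<^sup>2 * min \<epsilon> (1 / 2) \<ge> 1 / 2\<close> whether or not
  \<open>\<epsilon>\<close> exceeds \<open>1 / 2\<close>.\<close>

lemma exists_power_scale:
  fixes \<epsilon> :: real
  assumes "0 < \<epsilon>"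
  obtains N where "1024 \<le> 4 ^ N * min \<epsilon> (1 / 2)" "60 * 2 ^ N \<le> 7680 * max 1 (\<epsilon> powr (- 1 / 2))"
proof
  define r where "r = max 1 (\<epsilon> powr (- 1 / 2))"
  define N where "N = nat \<lceil>log 2 (64 * r)\<rceil>"
  have r: "1 \<le> r" by (simp add: r_def)
  have l: "0 \<le> log 2 (64 * r)" using r by simp
  then have N: "log 2 (64 * r) \<le> real N" "real N \<le> log 2 (64 * r) + 1" unfolding N_def by linarith+
  have "64 * r = 2 powr (log 2 (64 * r))" using r by simp
  also have "\<dots> \<le> 2 powr (real N)" using N by simp
  finally have 1: "64 * r \<le> 2 ^ N" by (simp add: powr_realpow)
  have "2 ^ N = 2 powr (real N)" by (simp add: powr_realpow)
  also have "\<dots> \<le> 2 powr (log 2 (64 * r) + 1)" using N by simp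
  also have "\<dots> = 128 * r" using r by (simp add: powr_add)
  finally show "60 * 2 ^ N \<le> 7680 * max 1 (\<epsilon> powr (- 1 / 2))" by (simp add: r_def)
  have "(64 * r) ^ 2 \<le> (2 ^ N) ^ 2" using 1 r by (intro power_mono) auto
  also have "(2 ^ N) ^ 2 = (4::real) ^ N" by (simp add: power2_eq_square flip: power_mult_distrib)
  finally have 4: "4096 * r\<^sup>2 \<le> 4 ^ N" by (simp add: power_mult_distrib)
  have "1 = (\<epsilon> powr (- 1 / 2))\<^sup>2 * \<epsilon>"
    using assms by (simp add: powr_minus powr_half_sqrt power_inverse field_simps)
  also have "\<dots> \<le> r\<^sup>2 * \<epsilon>"
    using assms by (intro mult_right_mono power_mono) (auto simp: r_def)
  finally have "1 \<le> r\<^sup>2 * \<epsilon>" .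
  moreover have "1 \<le> r\<^sup>2" using r by simp
  ultimately have "1 / 2 \<le> r\<^sup>2 * min \<epsilon> (1 / 2)" by (simp add: min_def)
  then have "2048 \<le> 4096 * r\<^sup>2 * min \<epsilon> (1 / 2)" by simp
  also have "\<dots> \<le> 4 ^ N * min \<epsilon> (1 / 2)" using 4 assms by (intro mult_right_mono) auto
  finally show "1024 \<le> 4 ^ N * min \<epsilon> (1 / 2)" by simp
qed

theorem theorem4:
  shows "\<exists>C>0.
    (\<forall>(f :: real \<Rightarrow> real) (\<epsilon> :: real).
       is_density lborel f \<and> log_concave_real f \<and> 0 < \<epsilon> \<longrightarrow>
       (\<exists>g m. piecewise_linear_distribution_real m g \<and>
          real m \<le> C * max 1 (\<epsilon> powr (- 1 / 2)) \<and>
          tv_dist lborel f g \<le> \<epsilon>)) \<and>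
    (\<forall>(f :: int \<Rightarrow> real) (\<epsilon> :: real).
       is_density (count_space UNIV) f \<and> log_concave_int f \<and> 0 < \<epsilon> \<longrightarrow>
       (\<exists>g m. piecewise_linear_distribution_int m g \<and>
          real m \<le> C * max 1 (\<epsilon> powr (- 1 / 2)) \<and>
          tv_dist (count_space UNIV) f g \<le> \<epsilon>))"
proof (intro exI[of _ 7680] conjI allI impI)
  fix f :: "real \<Rightarrow> real" and \<epsilon> :: real
  assume *: "is_density lborel f \<and> log_concave_real f \<and> 0 < \<epsilon>"
  then obtain N where N: "1024 \<le> 4 ^ N * min \<epsilon> (1 / 2)"
    "60 * 2 ^ N \<le> 7680 * max 1 (\<epsilon> powr (- 1 / 2))" using exists_power_scale by blast
  \<comment> \<open>Capping the accuracy at \<open>1 / 2\<close> meets the requirement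
    \<open>\<eta> < 1\<close> of the normalisation. For large \<open>\<epsilon>\<close> the number
    of pieces stays bounded, matching the \<open>max 1\<close> in the claim.\<close>
  have \<epsilon>: "0 < min \<epsilon> (1 / 2)" "min \<epsilon> (1 / 2) < 1" using * by auto
  obtain g m where g: "piecewise_linear_distribution_real m g" "m \<le> 60 * 2 ^ N"
    "tv_dist lborel f g \<le> min \<epsilon> (1 / 2)"
    using real_approximation[of f "min \<epsilon> (1 / 2)" N] * N(1) \<epsilon> by blast
  have "real m \<le> real (60 * 2 ^ N)" using g(2) of_nat_le_iff by blast
  then show "\<exists>g m. piecewise_linear_distribution_real m g \<and>
      real m \<le> 7680 * max 1 (\<epsilon> powr (- 1 / 2)) \<and> tv_dist lborel f g \<le> \<epsilon>"
    using g N(2) by (intro exI[of _ g] exI[of _ m]) auto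
next
  fix f :: "int \<Rightarrow> real" and \<epsilon> :: real
  assume *: "is_density (count_space UNIV) f \<and> log_concave_int f \<and> 0 < \<epsilon>"
  then obtain N where N: "1024 \<le> 4 ^ N * min \<epsilon> (1 / 2)"
    "60 * 2 ^ N \<le> 7680 * max 1 (\<epsilon> powr (- 1 / 2))" using exists_power_scale by blast
  have \<epsilon>: "0 < min \<epsilon> (1 / 2)" "min \<epsilon> (1 / 2) < 1" using * by auto
  obtain g m where g: "piecewise_linear_distribution_int m g" "m \<le> 60 * 2 ^ N"
    "tv_dist (count_space UNIV) f g \<le> min \<epsilon> (1 / 2)"
    using int_approximation[of f "min \<epsilon> (1 / 2)" N] * N(1) \<epsilon> by blast
  have "real m \<le> real (60 * 2 ^ N)" using g(2) of_nat_le_iff by blast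
  then show "\<exists>g m. piecewise_linear_distribution_int m g \<and>
      real m \<le> 7680 * max 1 (\<epsilon> powr (- 1 / 2)) \<and> tv_dist (count_space UNIV) f g \<le> \<epsilon>"
    using g N(2) by (intro exI[of _ g] exI[of _ m]) auto
qed simp

end
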